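(* Every $3$-qubit gate $U\in\mathcal{C}_3$ is a semi-Clifford operation.
   Context: An $n$-qubit gate is a unitary operator on $(\mathbb{C}^2)^{\otimes n}$; here $n=3$. The $n$-qubit Pauli group $\mathcal{P}_n$ is the group of order $4^{n+1}$ of all operators $c\,\sigma_1\otimes\cdots\otimes\sigma_n$ with $c\in\{\pm1,\pm i\}$ and $\sigma_j\in\{I,X,Y,Z\}$ (the identity and the Pauli matrices). The sets $\mathcal{C}_k$ (for fixed $n$) are defined recursively as sets of $n$-qubit unitaries: $\mathcal{C}_1=\mathcal{P}_n$ and $\mathcal{C}_{k+1}=\{U : U\mathcal{C}_1U^{\dagger}\subseteq\mathcal{C}_k\}$ for $k\ge 1$. An $n$-qubit unitary $U$ is called semi-Clifford if there is at least one maximal abelian subgroup $G$ of $\mathcal{P}_n$ such that $UGU^{\dagger}$ is a maximal abelian subgroup of $\mathcal{P}_n$ (possibly equal to $G$). *)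

theory Defs
  imports
    "HOL-Algebra.Group"
    "Jordan_Normal_Form.Schur_Decomposition"
begin

text \<open>
  Operators on the \<open>n\<close>-fold tensor power of \<open>\<complex>\<^sup>2\<close> are represented by their matrices of size
  \<open>2\<^sup>n\<close> in the computational basis; \<open>\<otimes>\<close> of operators becomes the Kronecker product.
  The adjoint is \<^const>\<open>mat_adjoint\<close>.
\<close>

definition qubit_gates :: "nat \<Rightarrow> complex mat set" where
  "qubit_gates n =
    {U \<in> carrier_mat (2 ^ n) (2 ^ n).
       U * mat_adjoint U = 1\<^sub>m (2 ^ n) \<and> mat_adjoint U * U = 1\<^sub>m (2 ^ n)}"

definition kronecker :: "complex mat \<Rightarrow> complex mat \<Rightarrow> complex mat" where
  "kronecker A B =
    mat (dim_row A * dim_row B) (dim_col A * dim_col B)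
      (\<lambda>(i, j). A $$ (i div dim_row B, j div dim_col B) * B $$ (i mod dim_row B, j mod dim_col B))"

definition tensor_list :: "complex mat list \<Rightarrow> complex mat" where
  "tensor_list As = foldr kronecker As (1\<^sub>m 1)"

definition pauli_I :: "complex mat" where
  "pauli_I = mat_of_rows_list 2 [[1, 0], [0, 1]]"

definition pauli_X :: "complex mat" where
  "pauli_X = mat_of_rows_list 2 [[0, 1], [1, 0]]"

definition pauli_Y :: "complex mat" where
  "pauli_Y = mat_of_rows_list 2 [[0, - \<i>], [\<i>, 0]]"

definition pauli_Z :: "complex mat" where
  "pauli_Z = mat_of_rows_list 2 [[1, 0], [0, - 1]]"

definition pauli_ops :: "nat \<Rightarrow> complex mat set" where
  "pauli_ops n =
    {c \<cdot>\<^sub>m tensor_list \<sigma>s | c \<sigma>s.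
       c \<in> {1, - 1, \<i>, - \<i>} \<and> length \<sigma>s = n \<and> set \<sigma>s \<subseteq> {pauli_I, pauli_X, pauli_Y, pauli_Z}}"

definition pauli_group :: "nat \<Rightarrow> complex mat monoid" where
  "pauli_group n = \<lparr>carrier = pauli_ops n, monoid.mult = (*), one = 1\<^sub>m (2 ^ n)\<rparr>"

definition conj_by :: "complex mat \<Rightarrow> complex mat \<Rightarrow> complex mat" where
  "conj_by U A = U * A * mat_adjoint U"

text \<open>The levels are numbered from 1; the value at 0 is a dummy that the other levels do not use.\<close>

fun clifford_level :: "nat \<Rightarrow> nat \<Rightarrow> complex mat set" where
  "clifford_level n 0 = {}"
| "clifford_level n (Suc 0) = pauli_ops n"
| "clifford_level n (Suc (Suc k)) =
    {U \<in> qubit_gates n. conj_by U ` clifford_level n (Suc 0) \<subseteq> clifford_level n (Suc k)}"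

definition abelian_subgroup :: "'a set \<Rightarrow> ('a, 'b) monoid_scheme \<Rightarrow> bool" where
  "abelian_subgroup H G \<longleftrightarrow> subgroup H G \<and> comm_group (G\<lparr>carrier := H\<rparr>)"

definition maximal_abelian_subgroup :: "'a set \<Rightarrow> ('a, 'b) monoid_scheme \<Rightarrow> bool" where
  "maximal_abelian_subgroup H G \<longleftrightarrow>
    abelian_subgroup H G \<and> (\<forall>K. abelian_subgroup K G \<and> H \<subseteq> K \<longrightarrow> K = H)"

definition semi_clifford :: "nat \<Rightarrow> complex mat \<Rightarrow> bool" where
  "semi_clifford n U \<longleftrightarrow>
    U \<in> qubit_gates n \<and>
    (\<exists>G. maximal_abelian_subgroup G (pauli_group n) \<and>
         maximal_abelian_subgroup (conj_by U ` G) (pauli_group n))"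

end

theory Submission
  imports Defs "HOL-Library.Z2" "HOL-Library.Product_Plus"
begin

text \<open>
  Label the Paulis $P_x$ up to phase by $x \in W = \mathbb{F}_2^6$ with its symplectic form
  $\omega$, and let $C_v = U P_v U^\dagger$. Since $U \in \mathcal{C}_3$, every $C_v$ is a Clifford
  involution, $C_v P_x C_v = \pm P_{S_v x}$, and $v \mapsto S_v$ is a homomorphism into commuting
  symplectic involutions. Let $F$ be the space of vectors fixed by all $S_v$. If $x \in F$, then $P_x$ commutes with each
  $C_v$ up to the sign of a character $\lambda_x(v)$; by irreducibility of the Paulis
  $U^\dagger P_x U$ is then itself a Pauli up to sign, and $\lambda_x \neq 0$ for $x \neq 0$. So it suffices to find a
  Lagrangian subspace of $W$ inside $F$.

  The key constraint comes from $C_v^2 = 1$: if $S_v x = x + z$ with $z \in F$ and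
  $\omega(x, z) = 0$, then $\lambda_z(v) = 0$. Commuting involutions in characteristic 2 have a common
  fixed vector in every nonzero subquotient, so there is $0 \neq l \in F$, and then $m \in l^\perp$ outside $\langle l\rangle$
  with $S_v m = m + \varphi(v) l$; the constraint gives $\varphi \lambda_l = 0$, hence
  $\varphi = 0$ and $m \in F$. Modulo $I = \langle l, m\rangle$ there is a fixed
  $c \in I^\perp$ outside $I$, with displacement $S_v c + c = \alpha(v) l + \beta(v) m$ and
  $\alpha \lambda_l + \beta \lambda_m = 0$; this forces $(\alpha, \beta) = 0$ or
  $(\alpha, \beta) = (\lambda_m, \lambda_l)$. In the second case any further $d \in I^\perp$ that
  is fixed modulo $\langle l, m, c\rangle$ is fixed modulo $I$, because the $S_v$ commute, so $d$ obeys the same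
  dichotomy and $d$ or $c + d$ lies in $F$. The vector of $F$ found in $I^\perp$ completes $I$ to a Lagrangian.
\<close>

section \<open>Symplectic spaces over the field with two elements\<close>

text \<open>The sign (-1)^b of a bit. The ring is left general because the character sums below use
  integers while phases of operators are complex.\<close>

definition sgn_bit :: "bit \<Rightarrow> 'a::ring_1" where
  "sgn_bit b = (if b = 0 then 1 else - 1)"

lemma sgn_bit_0 [simp]: "sgn_bit 0 = 1"
  and sgn_bit_1 [simp]: "sgn_bit 1 = - 1"
  by (simp_all add: sgn_bit_def)

lemma sgn_bit_add: "sgn_bit (a + b) = sgn_bit a * sgn_bit b"
  by (cases a; cases b) simp_all

lemma sgn_bit_square [simp]: "sgn_bit a * sgn_bit a = 1"
  by (cases a) simp_all

lemma sgn_bit_square_left [simp]: "sgn_bit a * (sgn_bit a * x) = x"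
  by (cases a) simp_all

lemma bit_add_self [simp]: "a + a = (0::bit)"
  by (cases a) simp_all

lemma bit_add_eq_0_iff: "a + b = 0 \<longleftrightarrow> a = (b::bit)"
  by (cases a; cases b) simp_all

text \<open>An abelian group with \<open>x + x = 0\<close> is a vector space over the field with two
  elements; its subspaces are the sets called \<open>closed\<close> below.\<close>

locale symplectic =
  fixes om :: "'w::ab_group_add \<Rightarrow> 'w \<Rightarrow> bit"
  assumes add_self [simp]: "x + x = (0::'w)"
    and om_add_left: "om (x + y) z = om x z + om y z"
    and om_add_right: "om x (y + z) = om x y + om x z"
    and om_self [simp]: "om x x = 0"
    and om_nondegenerate: "(\<And>y. om x y = 0) \<Longrightarrow> x = 0"
    and finite_UNIV: "finite (UNIV :: 'w set)"
begin

lemma add_self_left [simp]: "x + (x + y) = (y::'w)"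
  by (simp flip: add.assoc)

lemma add_eq_0_iff': "x + y = 0 \<longleftrightarrow> x = (y::'w)"
  by (metis add_self add_left_cancel)

lemma om_0_left [simp]: "om 0 x = 0"
  using om_add_left[of 0 0 x] by simp

lemma om_0_right [simp]: "om x 0 = 0"
  using om_add_right[of x 0 0] by simp

lemma om_commute: "om x y = om y x"
proof -
  have "om (x + y) (x + y) = om x x + om x y + (om y x + om y y)"
    by (simp only: om_add_left om_add_right ac_simps)
  then show ?thesis by (cases "om x y"; cases "om y x") simp_all
qed

definition closed :: "'w set \<Rightarrow> bool" where
  "closed A \<longleftrightarrow> 0 \<in> A \<and> (\<forall>x\<in>A. \<forall>y\<in>A. x + y \<in> A)"

definition perp :: "'w set \<Rightarrow> 'w set" where
  "perp A = {x. \<forall>a\<in>A. om a x = 0}"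

lemma closedI: "0 \<in> A \<Longrightarrow> (\<And>x y. x \<in> A \<Longrightarrow> y \<in> A \<Longrightarrow> x + y \<in> A) \<Longrightarrow> closed A"
  by (simp add: closed_def)

lemma closed_0: "closed A \<Longrightarrow> 0 \<in> A"
  and closed_add: "closed A \<Longrightarrow> x \<in> A \<Longrightarrow> y \<in> A \<Longrightarrow> x + y \<in> A"
  by (simp_all add: closed_def)

lemma closed_perp: "closed (perp A)"
  by (rule closedI) (auto simp: perp_def om_add_right)

text \<open>Translation by \<open>t\<close> permutes \<open>A\<close> and reverses every sign, so
  the sum equals its own negative.\<close>

lemma sum_sgn_bit_eq_0:
  fixes chi :: "'w \<Rightarrow> bit"
  assumes A: "closed A" and chi: "\<And>x y. x \<in> A \<Longrightarrow> y \<in> A \<Longrightarrow> chi (x + y) = chi x + chi y"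
    and t: "t \<in> A" "chi t = 1"
  shows "(\<Sum>x\<in>A. sgn_bit (chi x) :: int) = 0"
proof -
  have "(\<Sum>x\<in>A. sgn_bit (chi x) :: int) = (\<Sum>x\<in>A. sgn_bit (chi (t + x)))"
    by (rule sum.reindex_bij_witness[of _ "\<lambda>x. t + x" "\<lambda>x. t + x"])
      (use A t in \<open>auto intro: closed_add\<close>)
  also have "\<dots> = (\<Sum>x\<in>A. - sgn_bit (chi x))"
    by (rule sum.cong) (use t in \<open>auto simp: chi sgn_bit_add\<close>)
  finally show ?thesis by (simp add: sum_negf)
qed

text \<open>The signs of \<open>om a x\<close> are summed over \<open>a\<close> in \<open>A\<close>
  and all \<open>x\<close>, in both orders. By orthogonality of characters the inner sums vanish
  except at \<open>a = 0\<close> in one order and for \<open>x\<close> in \<open>perp A\<close> in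
  the other.\<close>

lemma card_times_card_perp:
  assumes A: "closed A"
  shows "card A * card (perp A) = card (UNIV :: 'w set)"
proof -
  have fin: "finite B" for B :: "'w set"
    using finite_UNIV by (rule rev_finite_subset) simp
  have left: "(\<Sum>x\<in>UNIV. sgn_bit (om a x) :: int) = (if a = 0 then int (card (UNIV :: 'w set)) else 0)" for a
  proof (cases "a = 0")
    case False
    then obtain t where "om a t = 1" using om_nondegenerate by (metis bit_not_zero_iff)
    with False show ?thesis
      by (simp add: sum_sgn_bit_eq_0[of UNIV "om a" t] closed_def om_add_right)
  qed simp
  have right: "(\<Sum>a\<in>A. sgn_bit (om a x) :: int) = (if x \<in> perp A then int (card A) else 0)" for x
  proof (cases "x \<in> perp A")
    case False
    then obtain t where "t \<in> A" "om t x = 1" by (auto simp: perp_def)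
    with False show ?thesis
      by (simp add: sum_sgn_bit_eq_0[OF A, of "\<lambda>a. om a x" t] om_add_left)
  qed (simp add: perp_def)
  have "int (card (UNIV :: 'w set)) = (\<Sum>a\<in>A. \<Sum>x\<in>UNIV. sgn_bit (om a x))"
    using A by (simp add: left sum.delta[OF fin] closed_def)
  also have "\<dots> = (\<Sum>x\<in>UNIV. \<Sum>a\<in>A. sgn_bit (om a x))"
    by (rule sum.swap)
  also have "\<dots> = int (card (perp A) * card A)"
    using finite_UNIV by (simp add: right sum.If_cases)
  finally show ?thesis by (simp only: of_nat_eq_iff mult.commute)
qed

text \<open>Isotropy puts \<open>A\<close> inside \<open>perp A\<close>, and the cardinality
  condition makes the two equally large.\<close>

lemma perp_eq_self:
  assumes A: "closed A" and iso: "\<And>x y. x \<in> A \<Longrightarrow> y \<in> A \<Longrightarrow> om x y = 0"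
    and card: "card A * card A = card (UNIV :: 'w set)"
  shows "perp A = A"
proof -
  have fin: "finite B" for B :: "'w set"
    using finite_UNIV by (rule rev_finite_subset) simp
  have "A \<noteq> {}" using A by (auto simp: closed_def)
  then have "card A > 0" using fin by (simp add: card_gt_0_iff)
  with card card_times_card_perp[OF A] have "card (perp A) = card A" by (metis mult_left_cancel not_gr0)
  moreover have "A \<subseteq> perp A" using iso by (auto simp: perp_def)
  ultimately show ?thesis using card_subset_eq fin by metis
qed

text \<open>Self-duality of the space: a nonzero \<open>chi\<close> has a proper kernel, so counting
  gives some \<open>k \<noteq> 0\<close> orthogonal to that kernel. Then \<open>om k\<close> and
  \<open>chi\<close> are nonzero functionals vanishing on the same hyperplane.\<close>

lemma additive_eq_om:
  fixes chi :: "'w \<Rightarrow> bit"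
  assumes chi: "\<And>x y. chi (x + y) = chi x + chi y"
  shows "\<exists>k. \<forall>x. chi x = om k x"
proof (cases "\<exists>t. chi t = 1")
  case False
  then have "\<forall>x. chi x = om 0 x" by simp
  then show ?thesis ..
next
  case True
  then obtain t where t: "chi t = 1" ..
  let ?A = "{x. chi x = 0}"
  have "chi 0 = 0" using chi[of 0 0] by simp
  then have A: "closed ?A" by (intro closedI) (simp_all add: chi)
  have "t \<notin> ?A" using t by simp
  then have "?A \<subset> UNIV" by blast
  then have "card ?A < card (UNIV :: 'w set)"
    using finite_UNIV by (intro psubset_card_mono)
  with card_times_card_perp[OF A] have "card (perp ?A) \<noteq> 1" by auto
  moreover have "0 \<in> perp ?A" using closed_perp by (rule closed_0)
  ultimately have "perp ?A \<noteq> {0}" by auto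
  with \<open>0 \<in> perp ?A\<close> obtain k where k: "k \<in> perp ?A" "k \<noteq> 0" by blast
  have k_A: "om k x = 0" if "chi x = 0" for x
    using k(1) that om_commute[of k x] by (simp add: perp_def)
  have k_t: "om k x = om k t" if "chi x = 1" for x
  proof -
    have "om k (x + t) = 0" using that t by (intro k_A) (simp add: chi)
    then show ?thesis by (simp only: om_add_right bit_add_eq_0_iff)
  qed
  obtain u where u: "om k u = 1" using om_nondegenerate[of k] k(2) by (metis bit_not_zero_iff)
  then have "chi u = 1" using k_A[of u] by (cases "chi u") simp_all
  then have "om k t = 1" using k_t u by simp
  then have "chi x = om k x" for x
    using k_A[of x] k_t[of x] by (cases "chi x") simp_all
  then show ?thesis by blast
qed

definition extend :: "'w \<Rightarrow> 'w set \<Rightarrow> 'w set" where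
  "extend x A = A \<union> (\<lambda>a. x + a) ` A"

lemma extend_iff: "y \<in> extend x A \<longleftrightarrow> y \<in> A \<or> x + y \<in> A"
  unfolding extend_def by (metis (no_types, lifting) Un_iff add_self_left image_iff)

lemma closed_extend:
  assumes "closed A"
  shows "closed (extend x A)"
proof (rule closedI)
  fix y z assume "y \<in> extend x A" "z \<in> extend x A"
  moreover have "(x + y) + (x + z) = y + z" by (simp add: ac_simps)
  moreover have "(x + y) + z = x + (y + z)" "y + (x + z) = x + (y + z)" by (simp_all add: ac_simps)
  ultimately show "y + z \<in> extend x A"
    unfolding extend_iff by (metis assms closed_add)
qed (use assms in \<open>auto simp: extend_iff closed_0\<close>)

lemma card_extend_le: "card (extend x A) \<le> 2 * card A"
  unfolding extend_def using finite_UNIV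
  by (metis card_Un_le card_image_le finite_subset mult_2 nat_add_left_cancel_le order_trans subset_UNIV)

lemma card_extend:
  assumes "closed A" "x \<notin> A"
  shows "card (extend x A) = 2 * card A"
proof -
  have "finite A" using finite_UNIV by (rule rev_finite_subset) simp
  moreover have "A \<inter> (\<lambda>a. x + a) ` A = {}"
  proof -
    { fix a assume "a \<in> A" "x + a \<in> A"
      then have "(x + a) + a \<in> A" using assms(1) closed_add by blast
      then have "x \<in> A" by (simp add: ac_simps)
      with assms(2) have False by simp }
    then show ?thesis by auto
  qed
  moreover have "card ((\<lambda>a. x + a) ` A) = card A" by (rule card_image) (simp add: inj_on_def)
  ultimately show ?thesis by (simp add: extend_def card_Un_disjoint)
qed

end

text \<open>The kernels of \<open>f\<close> and \<open>g\<close> cover everything, and a space over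
  two elements is not the union of two proper subspaces: the sum of a point outside one kernel and a
  point outside the other would lie outside both.\<close>

lemma additive_times_additive_eq_0:
  fixes f g :: "'w::plus \<Rightarrow> bit"
  assumes f: "\<And>v w. f (v + w) = f v + f w" and g: "\<And>v w. g (v + w) = g v + g w"
    and fg: "\<And>v. f v * g v = 0" and "g w \<noteq> 0"
  shows "f v = 0"
proof (rule ccontr)
  assume "f v \<noteq> 0"
  moreover from this have "g v = 0" using fg[of v] by simp
  moreover have "f w = 0" using assms(4) fg[of w] by simp
  ultimately show False using fg[of "v + w"] assms(4) by (simp add: f g)
qed

text \<open>The nonvanishing of \<open>f\<close>, \<open>g\<close> and \<open>f + g\<close> is
  linear independence over two elements, so the pair \<open>(f, g)\<close> is onto and has a dual
  pair of vectors.\<close>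

lemma independent_pair:
  fixes f g :: "'w::plus \<Rightarrow> bit"
  assumes f: "\<And>v w. f (v + w) = f v + f w" and g: "\<And>v w. g (v + w) = g v + g w"
    and nonzero: "f u1 \<noteq> 0" "g u2 \<noteq> 0" "f u3 + g u3 \<noteq> 0"
  obtains w1 w2 where "f w1 = 1" "g w1 = 0" "f w2 = 0" "g w2 = 1"
proof -
  have aux: "\<exists>w. f w = 1 \<and> g w = 0"
    if "f u1 = 1" "f u3 + g u3 = 1"
      and "\<And>v w. f (v + w) = f v + f w" "\<And>v w. g (v + w) = g v + g w"
    for f g :: "'w \<Rightarrow> bit" and u1
  proof (cases "g u1 = 0")
    case True
    with that show ?thesis by blast
  next
    case g: False
    show ?thesis
    proof (cases "f u3 = 0")
      case True
      with g that show ?thesis by (intro exI[of _ "u1 + u3"]) simp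
    next
      case False
      with that show ?thesis by (intro exI[of _ u3]) (cases "g u3"; simp)
    qed
  qed
  have "\<exists>w. f w = 1 \<and> g w = 0"
    using nonzero f g by (intro aux[of f u1 g]) simp_all
  moreover have "\<exists>w. g w = 1 \<and> f w = 0"
    using nonzero f g by (intro aux[of g u2 f]) (simp_all add: add.commute)
  ultimately show ?thesis using that by blast
qed

text \<open>The quadratic function \<open>a f + b g\<close> vanishes identically, hence so does its
  polarisation. Evaluating the latter at vectors dual to \<open>f\<close> and \<open>g\<close>
  expresses \<open>a\<close> by \<open>g\<close> and \<open>b\<close> by \<open>f\<close>, with a
  common coefficient.\<close>

lemma quadratic_relation:
  fixes a b f g :: "'w::plus \<Rightarrow> bit"
  assumes a: "\<And>v w. a (v + w) = a v + a w" and b: "\<And>v w. b (v + w) = b v + b w"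
    and f: "\<And>v w. f (v + w) = f v + f w" and g: "\<And>v w. g (v + w) = g v + g w"
    and rel: "\<And>v. a v * f v + b v * g v = 0"
    and nonzero: "f u1 \<noteq> 0" "g u2 \<noteq> 0" "f u3 + g u3 \<noteq> 0"
  shows "\<exists>t. \<forall>v. a v = t * g v \<and> b v = t * f v"
proof -
  have expand: "(p + p') * (q + q') + (r + r') * (s + s') =
      (p * q + r * s) + (p' * q' + r' * s') + (p * q' + p' * q + (r * s' + r' * s))"
    for p p' q q' r r' s s' :: bit
    by (simp only: distrib_left distrib_right ac_simps)
  have polar: "a v * f w + a w * f v + (b v * g w + b w * g v) = 0" for v w
  proof -
    have "(a v + a w) * (f v + f w) + (b v + b w) * (g v + g w) = 0"
      using rel[of "v + w"] unfolding a b f g .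
    then show ?thesis unfolding expand rel by (simp only: add_0)
  qed
  obtain w1 w2 where w1: "f w1 = 1" "g w1 = 0" and w2: "f w2 = 0" "g w2 = 1"
    by (rule independent_pair[OF f g nonzero])
  have "a w1 = 0" "b w2 = 0" using rel[of w1] rel[of w2] w1 w2 by simp_all
  then have "a v + b w1 * g v = 0" "a w2 * f v + b v = 0" for v
    using polar[of v w1] polar[of w2 v]
    by (simp_all only: w1 w2 mult_zero_left mult_zero_right mult_1_left mult_1_right add_0 add_0_right)
  then have ab: "a v = b w1 * g v" "b v = a w2 * f v" for v
    by (simp_all only: bit_add_eq_0_iff)
  have "a w2 = b w1" using ab(1)[of w2] by (simp only: w2 mult_1_right)
  then have "b v = b w1 * f v" for v using ab(2)[of v] by (rule subst)
  then show ?thesis using ab(1) by blast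
qed

section \<open>Fixed Lagrangian subspaces\<close>

text \<open>
  Only the values \<open>lam x v\<close> at vectors \<open>x\<close> fixed by all \<open>S w\<close> matter: there \<open>lam x v\<close> records
  whether $C_v$ and $P_x$ commute or anticommute. The assumption \<open>lam_shift\<close> is what remains of $C_v^2 = 1$.
\<close>

locale clifford_action = symplectic om for om :: "'w::ab_group_add \<Rightarrow> 'w \<Rightarrow> bit" +
  fixes S :: "'w \<Rightarrow> 'w \<Rightarrow> 'w" and lam :: "'w \<Rightarrow> 'w \<Rightarrow> bit"
  assumes S_add: "S v (x + y) = S v x + S v y"
    and S_comp: "S (v + w) x = S v (S w x)"
    and S_0: "S 0 x = x"
    and om_S: "om (S v x) (S v y) = om x y"
    and lam_add_left: "(\<And>v. S v x = x) \<Longrightarrow> (\<And>v. S v y = y) \<Longrightarrow> lam (x + y) v = lam x v + lam y v"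
    and lam_add_right: "(\<And>v. S v x = x) \<Longrightarrow> lam x (v + w) = lam x v + lam x w"
    and lam_nonzero: "(\<And>v. S v x = x) \<Longrightarrow> x \<noteq> 0 \<Longrightarrow> \<exists>v. lam x v \<noteq> 0"
    and lam_shift: "S v x = x + z \<Longrightarrow> (\<And>v. S v z = z) \<Longrightarrow> om x z = 0 \<Longrightarrow> lam z v = 0"
    and card_UNIV: "card (UNIV :: 'w set) = 64"
begin

section \<open>Fixed vectors modulo invariant subspaces\<close>

definition F :: "'w set" where "F = {x. \<forall>v. S v x = x}"

lemma F_D: "x \<in> F \<Longrightarrow> S v x = x"
  by (simp add: F_def)

lemma S_S: "S v (S v x) = x"
  using S_comp[of v v x] by (simp add: S_0)

lemma S_commute: "S v (S w x) = S w (S v x)"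
  using S_comp[of v w x] S_comp[of w v x] by (simp add: add.commute)

lemma S_zero [simp]: "S v 0 = 0"
  using S_add[of v 0 0] by simp

lemma closed_F: "closed F"
  by (rule closedI) (simp_all add: F_def S_add)

text \<open>Commuting unipotents have a common fixed vector in the nonzero quotient
  \<open>K / (K \<inter> J)\<close>. The operators are treated one at a time: if \<open>x\<close> is
  not fixed by \<open>S w\<close> modulo \<open>J\<close>, then \<open>S w x + x\<close> replaces
  it.\<close>

lemma exists_fixed_modulo:
  assumes J: "closed J" "\<And>v x. x \<in> J \<Longrightarrow> S v x \<in> J"
    and K: "closed K" "\<And>v x. x \<in> K \<Longrightarrow> S v x \<in> K"
    and nsub: "\<not> K \<subseteq> J"
  shows "\<exists>x\<in>K - J. \<forall>v. S v x + x \<in> J"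
proof -
  have "\<exists>x\<in>K - J. \<forall>v\<in>T. S v x + x \<in> J" if "finite T" for T
    using that
  proof induction
    case (insert w T)
    then obtain x where x: "x \<in> K - J" "\<forall>v\<in>T. S v x + x \<in> J" by blast
    show ?case
    proof (cases "S w x + x \<in> J")
      case True
      with x show ?thesis by auto
    next
      case False
      \<comment> \<open>Since \<open>S w\<close> is an involution, \<open>(S w + 1)^2 = 0\<close>
        and \<open>S w\<close> fixes \<open>?y\<close> exactly; commutativity keeps
        \<open>?y\<close> fixed modulo \<open>J\<close> by the operators already treated.\<close>
      let ?y = "S w x + x"
      have "?y \<in> K" using x K closed_add by auto
      moreover have "S w ?y + ?y = 0" by (simp add: S_add S_S ac_simps)
      moreover have "S v ?y + ?y \<in> J" if "v \<in> T" for v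
      proof -
        have "S v ?y + ?y = S w (S v x + x) + (S v x + x)"
          by (simp add: S_add S_commute[of v w] ac_simps)
        also have "\<dots> \<in> J" using that x J closed_add by auto
        finally show ?thesis .
      qed
      ultimately show ?thesis using False J(1) closed_0 by (intro bexI[of _ ?y]) auto
    qed
  qed (use nsub in auto)
  from this[OF finite_UNIV] show ?thesis by auto
qed

lemma perp_invariant:
  assumes "\<And>v x. x \<in> A \<Longrightarrow> S v x \<in> A" "x \<in> perp A"
  shows "S v x \<in> perp A"
  using assms om_S[of v _ "S v x"] om_S[of v] by (auto simp: perp_def) (metis S_S om_S)

text \<open>As \<open>card A\<close> times \<open>card (perp A)\<close> is 64, a
  \<open>perp A\<close> inside \<open>B\<close> would force \<open>64 \<le> n * m\<close>. This
  supplies the vectors outside \<open>B\<close> from which each extension step starts.\<close>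

lemma not_perp_subset:
  assumes A: "closed A" and le: "card A \<le> n" and B: "card B \<le> m" and lt: "n * m < 64"
  shows "\<not> perp A \<subseteq> B"
proof
  assume "perp A \<subseteq> B"
  then have "card (perp A) \<le> m"
    using B finite_UNIV by (meson card_mono finite_subset order_trans subset_UNIV)
  then have "card A * card (perp A) \<le> n * m" using le by (rule mult_le_mono[rotated])
  then show False using card_times_card_perp[OF A] card_UNIV lt by simp
qed

text \<open>The displacement of \<open>x\<close> is \<open>f v\<close> times \<open>l\<close> with
  \<open>f\<close> additive. By \<open>lam_shift\<close> the product of \<open>f\<close> and
  \<open>lam l\<close> vanishes pointwise, and \<open>lam l\<close> is not zero, so \<open>f\<close>
  is.\<close>

lemma fixed_if_shifted_by_fixed:
  assumes l: "l \<in> F" "l \<noteq> 0" and om: "om x l = 0" and shift: "\<And>v. S v x + x \<in> {0, l}"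
  shows "x \<in> F"
proof -
  define f where "f v = (if S v x = x then 0 else 1 :: bit)" for v
  have S_x: "S v x = (if f v = 0 then x else x + l)" for v
    using shift[of v] by (auto simp: f_def add_eq_0_iff' add.commute)
  have "S v x = x" for v
  proof -
    have "x + l \<noteq> x" using l(2) by simp
    then have f_add: "f (v + w) = f v + f w" for v w
      using S_x[of "v + w"] S_x[of v] S_x[of w] S_comp[of v w x] F_D[OF l(1), of v] 
      by (cases "f v"; cases "f w"; cases "f (v + w)") (auto simp: S_add ac_simps)
    have "f v * lam l v = 0" for v
      using S_x[of v] lam_shift[of v x l] F_D[OF l(1)] om by (cases "f v") auto
    moreover obtain w where "lam l w \<noteq> 0" using lam_nonzero F_D[OF l(1)] l(2) by blast
    ultimately have "f v = 0"
      using additive_times_additive_eq_0[of f "lam l" w v] f_add lam_add_right F_D[OF l(1)] by blast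
    then show ?thesis using S_x by simp
  qed
  then show ?thesis by (simp add: F_def)
qed

lemma closed_singleton_0: "closed {0}"
  by (simp add: closed_def)

text \<open>The displacement is \<open>a v\<close> times \<open>l\<close> plus \<open>b v\<close>
  times \<open>m\<close>. The constraint \<open>lam_shift\<close> becomes the relation in
  \<open>quadratic_relation\<close>, whose parameter \<open>t\<close> gives the two
  alternatives.\<close>

lemma fixed_plane_shift:
  assumes l: "l \<in> F" "l \<noteq> 0" and m: "m \<in> F" "m \<noteq> 0" "m \<noteq> l"
    and om: "om x l = 0" "om x m = 0"
    and shift: "\<And>v. S v x + x \<in> {0, l, m, m + l}"
  shows "(\<forall>v. S v x = x) \<or>
    (\<forall>v. S v x = x + ((if lam m v = 0 then 0 else l) + (if lam l v = 0 then 0 else m)))"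
proof -
  define sc where "sc b y = (if b = 0 then 0 else y)" for b :: bit and y :: 'w
  have sc_simps [simp]: "sc 0 y = 0" "sc 1 y = y" for y
    by (simp_all add: sc_def)
  have sc_add: "sc (b + b') y = sc b y + sc b' y" for b b' y
    by (cases b; cases b') simp_all
  have inj: "sc b l + sc c m = sc b' l + sc c' m \<longleftrightarrow> b = b' \<and> c = c'" for b c b' c'
    using l(2) m(2,3)
    by (cases b; cases c; cases b'; cases c')
      (auto simp: add_eq_0_iff' eq_commute[of 0] add.commute[of l m])
  have sc_F: "sc b l + sc c m \<in> F" for b c
    by (cases b; cases c) (use l m closed_F in \<open>auto intro: closed_0 closed_add\<close>)
  have "\<exists>b c. S v x + x = sc b l + sc c m" for v
  proof -
    have "0 = sc 0 l + sc 0 m" "l = sc 1 l + sc 0 m" "m = sc 0 l + sc 1 m" "m + l = sc 1 l + sc 1 m"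
      by (simp_all add: add.commute)
    then show ?thesis using shift[of v] by (metis insertE singletonD)
  qed
  then obtain a b where ab: "\<And>v. S v x + x = sc (a v) l + sc (b v) m" by metis
  then have S_x: "S v x = x + (sc (a v) l + sc (b v) m)" for v
    by (metis add_self_left add.commute)
  have add: "a (v + w) = a v + a w \<and> b (v + w) = b v + b w" for v w
  proof -
    have "S (v + w) x = S v x + S v (sc (a w) l + sc (b w) m)"
      unfolding S_comp S_x[of w] by (rule S_add)
    also have "\<dots> = x + ((sc (a v) l + sc (b v) m) + (sc (a w) l + sc (b w) m))"
      by (simp only: S_x[of v] F_D[OF sc_F] ac_simps)
    also have "\<dots> = x + (sc (a v + a w) l + sc (b v + b w) m)"
      by (simp only: sc_add ac_simps)
    finally show ?thesis unfolding S_x by (simp add: inj)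
  qed
  note lam_F = lam_add_left[OF F_D F_D] lam_add_right[OF F_D]
  have rel: "a v * lam l v + b v * lam m v = 0" for v
  proof -
    have "lam (sc (a v) l + sc (b v) m) v = 0"
    proof (rule lam_shift[OF S_x F_D[OF sc_F]])
      show "om x (sc (a v) l + sc (b v) m) = 0"
        by (cases "a v"; cases "b v") (simp_all add: om om_add_right)
    qed
    then show ?thesis
      by (cases "a v"; cases "b v") (simp_all add: lam_F l m)
  qed
  \<comment> \<open>Nonvanishing of \<open>lam\<close> at \<open>l\<close>, \<open>m\<close> and
    \<open>l + m\<close> makes \<open>lam l\<close> and \<open>lam m\<close> linearly
    independent.\<close>
  obtain u1 where u1: "lam l u1 \<noteq> 0" using lam_nonzero F_D l by blast
  obtain u2 where u2: "lam m u2 \<noteq> 0" using lam_nonzero F_D m by blast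
  have "l + m \<noteq> 0" using m(3) by (simp add: add_eq_0_iff')
  then obtain u3 where u3: "lam (l + m) u3 \<noteq> 0" 
    using lam_nonzero F_D closed_add[OF closed_F l(1) m(1)] by blast
  obtain t where t: "\<And>v. a v = t * lam m v" "\<And>v. b v = t * lam l v"
    using quadratic_relation[of a b "lam l" "lam m" u1 u2 u3] add rel u1 u2 u3 lam_F l m by metis
  show ?thesis
  proof (cases "t = 0")
    case True
    then have "\<forall>v. S v x = x" by (simp add: S_x t)
    then show ?thesis ..
  next
    case False
    then have "\<forall>v. S v x = x + (sc (lam m v) l + sc (lam l v) m)" by (simp add: S_x t)
    then show ?thesis unfolding sc_def ..
  qed
qed

theorem exists_fixed_lagrangian:
  "\<exists>L\<subseteq>F. closed L \<and> (\<forall>x\<in>L. \<forall>y\<in>L. om x y = 0) \<and> card L = 8"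
proof -
  have "\<exists>x\<in>UNIV - {0}. \<forall>v. S v x + x \<in> {0}"
  proof (rule exists_fixed_modulo)
    show "\<not> UNIV \<subseteq> {0::'w}"
      using card_UNIV by (auto dest: card_mono[rotated])
  qed (simp_all add: closed_def)
  then obtain l where "l \<noteq> 0" "\<And>v. S v l + l = 0" by auto
  then have l: "l \<in> F" "l \<noteq> 0" by (simp_all add: F_def add_eq_0_iff')
  let ?A1 = "extend l {0}"
  have A1: "closed ?A1" "?A1 = {0, l}" "card ?A1 = 2"
    using closed_extend[OF closed_singleton_0] card_extend[OF closed_singleton_0, of l] l
    by (auto simp: extend_def)
  have A1_inv: "S v x \<in> ?A1" if "x \<in> ?A1" for v x
    using that F_D[OF l(1)] by (auto simp: A1(2))
  have "\<exists>x\<in>perp ?A1 - ?A1. \<forall>v. S v x + x \<in> ?A1"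
    using not_perp_subset[of ?A1 2 ?A1 2] A1
    by (intro exists_fixed_modulo A1(1) A1_inv closed_perp perp_invariant) auto
  then obtain m where m: "m \<in> perp ?A1" "m \<notin> {0, l}" "\<And>v. S v m + m \<in> {0, l}"
    unfolding A1(2) by auto
  have om_lm: "om l m = 0" using m(1) by (auto simp: perp_def A1(2))
  have m_F: "m \<in> F"
    using fixed_if_shifted_by_fixed[OF l, of m] m om_lm by (simp add: om_commute)
  let ?A2 = "extend m ?A1"
  have A2: "closed ?A2" "?A2 = {0, l, m, m + l}" "card ?A2 = 4"
    using closed_extend[OF A1(1)] card_extend[OF A1(1), of m] m(2) A1(3)
    by (auto simp: extend_def A1(2))
  have A2_F: "?A2 \<subseteq> F"
    using l m_F closed_F by (auto simp: A2(2) intro: closed_0 closed_add)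
  have A2_inv: "S v x \<in> ?A2" if "x \<in> ?A2" for v x
    using that A2_F F_D by fastforce
  have perp_A2: "om x l = 0" "om x m = 0" if "x \<in> perp ?A2" for x
    using that om_commute[of x] by (auto simp: perp_def A2(2))
  \<comment> \<open>\<open>?A2\<close> is isotropic of order 4, so one further fixed vector
    orthogonal to it completes a subspace of order 8.\<close>
  have lagrangianI: ?thesis if x: "x \<in> F" "x \<in> perp ?A2" "x \<notin> ?A2" for x
  proof (intro exI conjI ballI)
    show "extend x ?A2 \<subseteq> F"
    proof
      fix y assume "y \<in> extend x ?A2"
      then have "y \<in> F \<or> x + y \<in> F" using A2_F by (auto simp: extend_iff)
      then show "y \<in> F" using closed_add[OF closed_F x(1), of "x + y"] by auto
    qed
    show "closed (extend x ?A2)" using A2(1) by (rule closed_extend)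
    show "card (extend x ?A2) = 8" using card_extend[OF A2(1) x(3)] A2(3) by simp
    have split: "\<exists>s y'. y = s + y' \<and> s \<in> {0, x} \<and> y' \<in> ?A2" if "y \<in> extend x ?A2" for y
    proof (cases "y \<in> ?A2")
      case True
      then show ?thesis by (intro exI[of _ 0] exI[of _ y]) simp
    next
      case False
      then have "y = x + (x + y)" "x + y \<in> ?A2" using that by (simp_all add: extend_iff)
      then show ?thesis by (intro exI[of _ x] exI[of _ "x + y"]) simp
    qed
    fix y z assume y: "y \<in> extend x ?A2" and z: "z \<in> extend x ?A2"
    obtain s y' where y': "y = s + y'" "s \<in> {0, x}" "y' \<in> ?A2" using split[OF y] by blast
    obtain t z' where z': "z = t + z'" "t \<in> {0, x}" "z' \<in> ?A2" using split[OF z] by blast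
    have om_x: "om x u = 0 \<and> om u x = 0" if "u \<in> ?A2" for u
      using x(2) that om_commute[of x u] by (auto simp: perp_def)
    have "om y' z' = 0"
      using y'(3) z'(3) om_lm om_commute[of m l]
      unfolding A2(2) by (auto simp: om_add_left om_add_right)
    then show "om y z = 0"
      using y'(2) z'(2) om_x[OF y'(3)] om_x[OF z'(3)]
      by (auto simp: y'(1) z'(1) om_add_left om_add_right)
  qed
  \<comment> \<open>By the dichotomy this is the only nonzero displacement of a vector of
    \<open>perp ?A2\<close> fixed modulo \<open>?A2\<close>; being the same for all such vectors, it
    cancels in the sum of two of them.\<close>
  define D where "D v = (if lam m v = 0 then 0 else l) + (if lam l v = 0 then 0 else m)" for v
  have shift: "x \<in> F \<or> (\<forall>v. S v x = x + D v)"
    if "x \<in> perp ?A2" "\<And>v. S v x + x \<in> ?A2" for x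
    using fixed_plane_shift[OF l m_F, of x] m(2) perp_A2[OF that(1)] that(2)
    unfolding A2(2) D_def by (auto simp: F_def)
  have "\<exists>x\<in>perp ?A2 - ?A2. \<forall>v. S v x + x \<in> ?A2"
    using not_perp_subset[of ?A2 4 ?A2 4] A2(1,3)
    by (intro exists_fixed_modulo A2(1) A2_inv closed_perp perp_invariant) auto
  then obtain c where c: "c \<in> perp ?A2" "c \<notin> ?A2" "\<And>v. S v c + c \<in> ?A2" by auto
  show ?thesis
  proof (cases "c \<in> F")
    case True
    then show ?thesis using lagrangianI c by blast
  next
    case False
    then have S_c: "S v c = c + D v" for v using shift c by blast
    have D_A2: "D v \<in> ?A2" for v using c(3)[of v] by (simp add: S_c ac_simps)
    let ?A3 = "extend c ?A2"
    have A3: "closed ?A3" "card ?A3 \<le> 8"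
      using closed_extend[OF A2(1)] card_extend_le[of c ?A2] A2(3) by simp_all
    have A3_inv: "S v x \<in> ?A3" if x_A3: "x \<in> ?A3" for v x
    proof -
      consider "x \<in> ?A2" | "c + x \<in> ?A2"
        using x_A3 extend_iff[of x c ?A2] by blast
      then show ?thesis
      proof cases
        case 1
        then show ?thesis using A2_inv by (simp add: extend_iff)
      next
        case 2
        have "c + S v x = D v + S v (c + x)" by (simp add: S_add S_c ac_simps)
        also have "\<dots> \<in> ?A2" using 2 A2_inv D_A2 A2(1) closed_add by blast
        finally show ?thesis by (simp add: extend_iff)
      qed
    qed
    have "\<exists>x\<in>perp ?A2 - ?A3. \<forall>v. S v x + x \<in> ?A3"
      using not_perp_subset[of ?A2 4 ?A3 8] A2(1,3) A3(2)
      by (intro exists_fixed_modulo A3(1) A3_inv closed_perp perp_invariant A2_inv) auto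
    then obtain d where d: "d \<in> perp ?A2" "d \<notin> ?A3" "\<And>v. S v d + d \<in> ?A3" by auto
    \<comment> \<open>If \<open>S v d + d\<close> lies in \<open>?A2\<close>, it is fixed by
      \<open>S w\<close>; otherwise it lies in the coset of \<open>c\<close>, and applying
      \<open>S w\<close> adds \<open>D w\<close>. The remaining terms are symmetric in
      \<open>v\<close> and \<open>w\<close>, so commutativity will constrain
      \<open>D\<close>.\<close>
    have twice: "S w (S v d) = S v d + S w d + d + (if S v d + d \<in> ?A2 then 0 else D w)" for v w
    proof (cases "S v d + d \<in> ?A2")
      case True
      then have fixed: "S w (S v d + d) = S v d + d" using A2_F F_D by blast
      have "S w (S v d) = S w (S v d + d) + S w d" by (simp add: S_add ac_simps)
      also have "\<dots> = (S v d + d) + S w d" by (simp only: fixed)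
      finally show ?thesis using True by (simp add: ac_simps)
    next
      case False
      then have "c + (S v d + d) \<in> ?A2" using d(3)[of v] extend_iff[of "S v d + d" c ?A2] by blast
      then have fixed: "S w (c + (S v d + d)) = c + (S v d + d)" using A2_F F_D by blast
      have "S w (S v d) = S w (c + (S v d + d)) + S w c + S w d" by (simp add: S_add ac_simps)
      also have "\<dots> = c + (S v d + d) + (c + D w) + S w d" by (simp only: fixed S_c)
      finally show ?thesis using False by (simp add: ac_simps)
    qed
    have "S v d + d \<in> ?A2" for v
    proof (rule ccontr)
      assume v: "S v d + d \<notin> ?A2"
      have D_cases: "D w \<in> {0, D v}" for w
      proof -
        have "S v d + S w d + d + D w = S w (S v d)" using v by (simp only: twice if_False)
        also have "\<dots> = S v (S w d)" by (rule S_commute)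
        also have "\<dots> = S w d + S v d + d + (if S w d + d \<in> ?A2 then 0 else D v)" by (rule twice)
        finally have "D w = (if S w d + d \<in> ?A2 then 0 else D v)"
          by (simp only: add.commute[of "S w d" "S v d"] add_left_cancel)
        then show ?thesis by (simp split: if_splits)
      qed
      obtain u1 where u1: "lam l u1 \<noteq> 0" using lam_nonzero F_D l by blast
      obtain u2 where u2: "lam m u2 \<noteq> 0" using lam_nonzero F_D m_F m(2) by blast
      have "l + m \<noteq> 0" using m(2) by (auto simp: add_eq_0_iff')
      then obtain u3 where u3: "lam (l + m) u3 \<noteq> 0" 
        using lam_nonzero F_D closed_add[OF closed_F l(1) m_F] by blast
      \<comment> \<open>\<open>D\<close> takes both values \<open>m\<close> and \<open>l\<close>,
        which cannot both lie in \<open>{0, D v}\<close>.\<close>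
      obtain w1 w2 where "lam l w1 = 1" "lam m w1 = 0" "lam l w2 = 0" "lam m w2 = 1"
        using independent_pair[of "lam l" "lam m" u1 u2 u3] u1 u2 u3
          lam_add_left[OF F_D F_D] lam_add_right[OF F_D] l m_F by metis
      then have "D w1 = m" "D w2 = l" by (simp_all add: D_def)
      then show False using D_cases[of w1] D_cases[of w2] l(2) m(2) by auto
    qed
    then consider "d \<in> F" | "\<And>v. S v d = d + D v" using shift d(1) by blast
    then show ?thesis
    proof cases
      case 1
      then show ?thesis using lagrangianI d by (simp add: extend_iff)
    next
      case 2
      \<comment> \<open>Both vectors are displaced by the same \<open>D v\<close>, so the
        displacements cancel.\<close>
      then have "c + d \<in> F" by (simp add: F_def S_add S_c ac_simps)
      moreover have "c + d \<in> perp ?A2" using c d closed_add closed_perp by blast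
      moreover have "c + d \<notin> ?A2" using d(2) by (simp add: extend_iff)
      ultimately show ?thesis using lagrangianI by blast
    qed
  qed
qed

end

section \<open>Third-level conjugation of an irreducible Pauli representation\<close>

lemma sgn_bit_inj: "sgn_bit a = (sgn_bit b :: complex) \<longleftrightarrow> a = b"
  by (cases a; cases b) simp_all

lemma sgn_bit_nonzero [simp]: "sgn_bit a \<noteq> (0 :: complex)"
  by (cases a) simp_all

text \<open>An abstract monoid with scalars makes products total and associative without carrier
  conditions. The assumption \<open>irreducible\<close> is the conclusion of Schur's lemma.\<close>

locale pauli_representation = symplectic om for om :: "'w::ab_group_add \<Rightarrow> 'w \<Rightarrow> bit" +
  fixes sc :: "complex \<Rightarrow> 'm::monoid_mult \<Rightarrow> 'm"
    and P :: "'w \<Rightarrow> 'm"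
    and ph :: "'w \<Rightarrow> 'w \<Rightarrow> complex"
  assumes sc_mult_left [simp]: "sc a A * B = sc a (A * B)"
    and sc_mult_right [simp]: "A * sc a B = sc a (A * B)"
    and sc_sc [simp]: "sc a (sc b A) = sc (a * b) A"
    and sc_1 [simp]: "sc 1 A = A"
    and sc_one_inj: "sc a 1 = sc b 1 \<Longrightarrow> a = b"
    and P_mult: "P x * P y = sc (ph x y) (P (x + y))"
    and ph_nonzero [simp]: "ph x y \<noteq> 0"
    and ph_commute: "ph x y = sgn_bit (om x y) * ph y x"
    and P_0 [simp]: "P 0 = 1"
    and P_square [simp]: "P x * P x = 1"
    and irreducible: "(\<And>x. A * P x = P x * A) \<Longrightarrow> \<exists>c. A = sc c 1"
begin

lemma P_commute: "P x * P y = sc (sgn_bit (om x y)) (P y * P x)"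
  by (simp add: P_mult ph_commute[of x y] add.commute)

lemma P_square_left [simp]: "P x * (P x * A) = A"
  by (simp flip: mult.assoc)

lemma sc_invertible_inj:
  assumes "sc a A = sc b A" "A * B = 1"
  shows "a = b"
proof (rule sc_one_inj)
  have "sc a A * B = sc b A * B" by (simp only: assms(1))
  then show "sc a 1 = sc b 1" by (simp add: assms(2))
qed

lemma sc_cancel:
  assumes "sc a A = sc b B" "a \<noteq> 0"
  shows "A = sc (b / a) B"
proof -
  have "sc (inverse a) (sc a A) = sc (inverse a) (sc b B)" by (simp only: assms(1))
  then show ?thesis using assms(2) by (simp add: field_simps)
qed

text \<open>Conjugation by \<open>P t\<close> multiplies \<open>P x\<close> by the sign of
  \<open>om x t\<close>. Proportional Paulis therefore define the same character, and nondegeneracy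
  identifies the labels.\<close>

lemma P_eq_sc_P:
  assumes "P x = sc b (P y)"
  shows "x = y" "b = 1"
proof -
  have "sgn_bit (om x t) = (sgn_bit (om y t) :: complex)" for t
  proof -
    have conj: "P t * P z * P t = sc (sgn_bit (om z t)) (P z)" for z
    proof -
      have "P z * P t * P t = sc (sgn_bit (om z t)) (P t * P z * P t)"
        by (simp add: P_commute[of z t])
      then have "sc (sgn_bit (om z t)) (P z) = sc (sgn_bit (om z t)) (sc (sgn_bit (om z t)) (P t * P z * P t))"
        by (simp add: mult.assoc)
      then show ?thesis by simp
    qed
    have "sc (sgn_bit (om x t)) (P x) = P t * P x * P t" by (rule conj[symmetric])
    also have "\<dots> = sc b (P t * P y * P t)" by (simp add: assms)
    also have "\<dots> = sc (sgn_bit (om y t)) (P x)" by (simp add: conj assms mult.commute)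
    finally show ?thesis by (rule sc_invertible_inj) (rule P_square)
  qed
  then have "om (x + y) t = 0" for t by (simp add: sgn_bit_inj om_add_left)
  then have "x + y = 0" by (rule om_nondegenerate)
  then show "x = y" by (simp add: add_eq_0_iff')
  then have "sc 1 (P y) = sc b (P y)" using assms by simp
  then have "1 = b" by (rule sc_invertible_inj) (rule P_square)
  then show "b = 1" by simp
qed

end

text \<open>\<open>V\<close> is the inverse of \<open>U\<close>. As \<open>U * P v * V\<close> is an
  involution, conjugation by it has the same factor on both sides, so no adjoint appears in
  \<open>clifford\<close>.\<close>

locale third_level = pauli_representation om sc P ph
  for om :: "'w::ab_group_add \<Rightarrow> 'w \<Rightarrow> bit"
    and sc :: "complex \<Rightarrow> 'm::monoid_mult \<Rightarrow> 'm" and P ph +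
  fixes U V :: 'm
  assumes UV [simp]: "U * V = 1" and VU [simp]: "V * U = 1"
    and clifford: "\<exists>c y. (U * P v * V) * P x * (U * P v * V) = sc c (P y)"
    and card_UNIV: "card (UNIV :: 'w set) = 64"
begin

section \<open>Conjugated Paulis and their action on labels\<close>

definition C :: "'w \<Rightarrow> 'm" where "C v = U * P v * V"

lemma UV_left [simp]: "U * (V * A) = A" and VU_left [simp]: "V * (U * A) = A"
  by (simp_all flip: mult.assoc)

lemma C_mult: "C v * C w = sc (ph v w) (C (v + w))"
proof -
  have "C v * C w = U * (P v * P w) * V" by (simp add: C_def mult.assoc)
  then show ?thesis by (simp add: P_mult C_def)
qed

lemma C_0 [simp]: "C 0 = 1"
  by (simp add: C_def)

lemma C_square [simp]: "C v * C v = 1"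
  by (simp add: C_def mult.assoc)

lemma C_square_left [simp]: "C v * (C v * A) = A"
  by (simp flip: mult.assoc)

lemma C_conj_P: "\<exists>e y. C v * P x * C v = sc (sgn_bit e) (P y)"
proof -
  obtain c y where cy: "C v * P x * C v = sc c (P y)" using clifford unfolding C_def by blast
  have "(C v * P x * C v) * (C v * P x * C v) = 1" by (simp add: mult.assoc)
  then have "sc (c * c) 1 = sc 1 1" unfolding cy by simp
  then have "c * c = 1" by (rule sc_one_inj)
  then have "c = sgn_bit 0 \<or> c = sgn_bit 1" by (simp add: square_eq_1_iff)
  then show ?thesis using cy by blast
qed

text \<open>Selected by choice; \<open>C_P_unique\<close> shows that the sign and the label
  \<open>S v x\<close> are determined.\<close>

definition sign :: "'w \<Rightarrow> 'w \<Rightarrow> bit" where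
  "sign v x = (SOME e. \<exists>y. C v * P x * C v = sc (sgn_bit e) (P y))"

definition S :: "'w \<Rightarrow> 'w \<Rightarrow> 'w" where
  "S v x = (SOME y. C v * P x * C v = sc (sgn_bit (sign v x)) (P y))"

lemma C_P_C: "C v * P x * C v = sc (sgn_bit (sign v x)) (P (S v x))"
proof -
  have "\<exists>y. C v * P x * C v = sc (sgn_bit (sign v x)) (P y)"
    unfolding sign_def by (rule someI_ex[OF C_conj_P])
  then show ?thesis unfolding S_def by (rule someI_ex)
qed

lemma C_P: "C v * P x = sc (sgn_bit (sign v x)) (P (S v x) * C v)"
proof -
  have "C v * P x = (C v * P x * C v) * C v" by (simp add: mult.assoc)
  then show ?thesis unfolding C_P_C by simp
qed

lemma C_P_left: "C v * (P x * A) = sc (sgn_bit (sign v x)) (P (S v x) * (C v * A))"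
  using C_P[of v x] by (metis mult.assoc sc_mult_left)

text \<open>Distinct Paulis are not proportional, so moving \<open>C v\<close> past
  \<open>P x\<close> determines both label and sign. The additivity and composition laws of
  \<open>S\<close> and \<open>sign\<close> are read off from this.\<close>

lemma C_P_unique:
  assumes "C v * P x = sc a (P y * C v)"
  shows "S v x = y" "sgn_bit (sign v x) = a"
proof -
  have "sc (sgn_bit (sign v x)) (P (S v x)) = C v * P x * C v" by (simp add: C_P_C)
  also have "\<dots> = sc a (P y)" by (simp add: assms mult.assoc)
  finally have "P (S v x) = sc (a / sgn_bit (sign v x)) (P y)"
    by (rule sc_cancel) simp
  from P_eq_sc_P[OF this] show "S v x = y" "sgn_bit (sign v x) = a" by simp_all
qed

lemma C_P_add: 
  "C v * P (x + y) =
    sc (sgn_bit (sign v x) * sgn_bit (sign v y) * ph (S v x) (S v y) / ph x y) (P (S v x + S v y) * C v)"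
proof (rule sc_cancel)
  have "sc (ph x y) (C v * P (x + y)) = C v * (P x * P y)" by (simp add: P_mult)
  also have "\<dots> = sc (sgn_bit (sign v x) * sgn_bit (sign v y)) (P (S v x) * P (S v y) * C v)"
    by (simp add: C_P_left C_P mult.assoc)
  finally show "sc (ph x y) (C v * P (x + y)) =
      sc (sgn_bit (sign v x) * sgn_bit (sign v y) * ph (S v x) (S v y)) (P (S v x + S v y) * C v)"
    by (simp add: P_mult)
qed simp

lemma C_add_P:
  "C (v + w) * P x = sc (sgn_bit (sign w x) * sgn_bit (sign v (S w x))) (P (S v (S w x)) * C (v + w))"
proof -
  have "sc (ph v w) (C (v + w) * P x) = C v * C w * P x" by (simp add: C_mult)
  also have "\<dots> = sc (sgn_bit (sign w x) * sgn_bit (sign v (S w x))) (P (S v (S w x)) * (C v * C w))"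
    by (simp add: C_P_left C_P mult.assoc)
  also have "\<dots> = sc (sgn_bit (sign w x) * sgn_bit (sign v (S w x)) * ph v w) (P (S v (S w x)) * C (v + w))"
    by (simp add: C_mult)
  finally have "C (v + w) * P x = sc (sgn_bit (sign w x) * sgn_bit (sign v (S w x)) * ph v w / ph v w)
    (P (S v (S w x)) * C (v + w))"
    by (rule sc_cancel) simp
  then show ?thesis by simp
qed

lemma om_S: "om (S v x) (S v y) = om x y"
proof -
  have prod: "C v * (P x * P y) * C v = sc (sgn_bit (sign v x) * sgn_bit (sign v y)) (P (S v x) * P (S v y))" for x y
    by (simp add: C_P_left C_P mult.assoc)
  have "sc (sgn_bit (sign v x) * sgn_bit (sign v y)) (P (S v x) * P (S v y)) = C v * (P x * P y) * C v"
    by (rule prod[symmetric])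
  also have "\<dots> = sc (sgn_bit (om x y)) (C v * (P y * P x) * C v)"
    by (simp add: P_commute[of x y])
  also have "\<dots> = sc (sgn_bit (om x y) * (sgn_bit (sign v x) * sgn_bit (sign v y))) (P (S v y) * P (S v x))"
    by (simp add: prod mult.commute)
  finally have "sc (sgn_bit (sign v x) * sgn_bit (sign v y) * sgn_bit (om (S v x) (S v y))) (P (S v y) * P (S v x)) = \<dots>"
    by (simp add: P_commute[of "S v x" "S v y"])
  then have "sgn_bit (sign v x) * sgn_bit (sign v y) * sgn_bit (om (S v x) (S v y)) =
      (sgn_bit (om x y) * (sgn_bit (sign v x) * sgn_bit (sign v y)) :: complex)"
    by (rule sc_invertible_inj[where B = "P (S v x) * P (S v y)"]) (simp add: mult.assoc)
  then show ?thesis by (simp add: sgn_bit_inj)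
qed

text \<open>Conjugating the rule for \<open>C v\<close> and \<open>P x\<close> back by
  \<open>U\<close> turns \<open>C v\<close> into \<open>P v\<close>.\<close>

lemma conj_P_if_fixed:
  assumes "\<And>v. S v x = x"
  shows "(V * P x * U) * P v = sc (sgn_bit (sign v x)) (P v * (V * P x * U))"
proof -
  have "V * (C v * P x) * U = P v * (V * P x * U)" by (simp add: C_def mult.assoc)
  moreover have "V * (P x * C v) * U = (V * P x * U) * P v" by (simp add: C_def mult.assoc)
  ultimately have "P v * (V * P x * U) = sc (sgn_bit (sign v x)) ((V * P x * U) * P v)"
    using C_P[of v x] by (simp add: assms)
  then show ?thesis by simp
qed

sublocale clifford_action om S "\<lambda>x v. sign v x"
proof
  show "S v (x + y) = S v x + S v y" for v x y
    using C_P_add by (rule C_P_unique)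
  show "S (v + w) x = S v (S w x)" for v w x
    using C_add_P by (rule C_P_unique)
  have "C 0 * P x = sc 1 (P x * C 0)" for x by simp
  then show "S 0 x = x" for x by (rule C_P_unique)
  show "om (S v x) (S v y) = om x y" for v x y by (rule om_S)
  show "card (UNIV :: 'w set) = 64" by (rule card_UNIV)
next
  fix x y v assume "\<And>v. S v x = x" "\<And>v. S v y = y"
  then have "sgn_bit (sign v (x + y)) = (sgn_bit (sign v x) * sgn_bit (sign v y) :: complex)"
    using C_P_unique(2)[OF C_P_add, of v x y] by simp
  then have "sgn_bit (sign v (x + y)) = (sgn_bit (sign v x + sign v y) :: complex)"
    by (simp only: sgn_bit_add)
  then show "sign v (x + y) = sign v x + sign v y" by (simp only: sgn_bit_inj)
next
  fix x v w assume "\<And>v. S v x = x"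
  then have "sgn_bit (sign (v + w) x) = (sgn_bit (sign v x) * sgn_bit (sign w x) :: complex)"
    using C_P_unique(2)[OF C_add_P, of v w x] by simp
  then have "sgn_bit (sign (v + w) x) = (sgn_bit (sign v x + sign w x) :: complex)"
    by (simp only: sgn_bit_add)
  then show "sign (v + w) x = sign v x + sign w x" by (simp only: sgn_bit_inj)
next
  fix x assume x: "\<And>v. S v x = x" "x \<noteq> 0"
  show "\<exists>v. sign v x \<noteq> 0"
  proof (rule ccontr)
    \<comment> \<open>A trivial character would make \<open>V * P x * U\<close> commute with all
      Paulis, hence scalar, and \<open>P x\<close> would be proportional to
      \<open>P 0\<close>.\<close>
    assume "\<not> (\<exists>v. sign v x \<noteq> 0)"
    then have "(V * P x * U) * P v = P v * (V * P x * U)" for v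
      using conj_P_if_fixed[OF x(1), of v] by simp
    then obtain c where "V * P x * U = sc c 1" using irreducible by blast
    then have "U * (V * P x * U) * V = U * sc c 1 * V" by simp
    then have "P x = sc c (P 0)" by (simp add: mult.assoc)
    then show False using x(2) P_eq_sc_P(1) by blast
  qed
next
  \<comment> \<open>Conjugating \<open>P x\<close> twice by \<open>C v\<close> does nothing. The
    first conjugation gives \<open>P (x + z)\<close> up to sign; the second, after splitting this
    into \<open>P x\<close> and \<open>P z\<close>, returns \<open>P x\<close> with the sign of
    \<open>sign v z\<close> left over, up to a squared phase equal to 1.\<close>
  fix v x z assume Sx: "S v x = x + z" and Sz: "\<And>v. S v z = z" and om: "om x z = 0"
  have ph: "ph x z = ph z x" using om ph_commute[of x z] by simp
  have "P (x + z) = sc (1 / ph x z) (P x * P z)" "P (x + z) = sc (1 / ph x z) (P z * P x)"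
    by (rule sc_cancel; simp add: P_mult ph add.commute)+
  note Pxz = this
  have "C v * P (x + z) * C v = sc (1 / ph x z) ((C v * P x * C v) * (C v * P z * C v))"
    by (simp add: Pxz(1) mult.assoc)
  also have "\<dots> = sc (1 / ph x z * (sgn_bit (sign v x) * sgn_bit (sign v z))) (P (x + z) * P z)"
    unfolding C_P_C Sx Sz by (simp add: mult.commute)
  also have "P (x + z) * P z = sc (1 / ph x z) (P x)"
    by (simp add: Pxz(1) mult.assoc)
  finally have twice: "C v * P (x + z) * C v =
    sc (sgn_bit (sign v x) * sgn_bit (sign v z) / (ph x z * ph x z)) (P x)"
    by (simp add: mult.commute)
  have "P x = sc (sgn_bit (sign v x)) (C v * P (x + z) * C v)"
  proof -
    have "P x = C v * (C v * P x * C v) * C v" by (simp add: mult.assoc)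
    also have "\<dots> = sc (sgn_bit (sign v x)) (C v * P (x + z) * C v)"
      unfolding C_P_C[of v x] Sx by simp
    finally show ?thesis .
  qed
  then have "P x = sc (sgn_bit (sign v x) * (sgn_bit (sign v x) * sgn_bit (sign v z) / (ph x z * ph x z))) (P x)"
    unfolding twice sc_sc .
  then have "sgn_bit (sign v x) * (sgn_bit (sign v x) * sgn_bit (sign v z) / (ph x z * ph x z)) = 1"
    by (rule P_eq_sc_P)
  then have "sgn_bit (sign v z) / (ph x z * ph x z) = 1"
    by (simp add: mult.assoc[symmetric])
  moreover have "ph x z * ph x z = 1"
  proof -
    have "P (x + z) * P (x + z) = sc (1 / ph x z * (1 / ph x z)) ((P x * P z) * (P z * P x))"
      by (subst Pxz(1), subst Pxz(2)) simp
    then have "sc 1 1 = sc (1 / ph x z * (1 / ph x z)) 1" by (simp add: mult.assoc)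
    then have "1 = 1 / ph x z * (1 / ph x z)" by (rule sc_one_inj)
    then show ?thesis by (simp add: field_simps)
  qed
  ultimately have "sgn_bit (sign v z) = (sgn_bit 0 :: complex)" by simp
  then show "sign v z = 0" by (simp only: sgn_bit_inj)
qed

text \<open>The character \<open>sign _ x\<close> is \<open>om k\<close> for some \<open>k\<close>,
  so \<open>P k * (V * P x * U)\<close> commutes with all Paulis and is a scalar. Comparing squares
  makes the scalar a sign.\<close>

lemma conj_P_fixed_is_pauli:
  assumes "x \<in> F"
  shows "\<exists>k e. U * P k * V = sc (sgn_bit e) (P x)"
proof -
  note x = F_D[OF assms]
  obtain k where k: "\<And>v. sign v x = om k v"
    using additive_eq_om[of "\<lambda>v. sign v x"] lam_add_right[OF x] by blast
  have "(P k * (V * P x * U)) * P v = P v * (P k * (V * P x * U))" for v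
  proof -
    have "(P k * (V * P x * U)) * P v = sc (sgn_bit (om k v)) (P k * P v * (V * P x * U))"
      using conj_P_if_fixed[OF x, of v] by (simp add: mult.assoc k)
    also have "\<dots> = P v * (P k * (V * P x * U))"
      by (simp add: P_commute[of k v]) (simp add: mult.assoc)
    finally show ?thesis .
  qed
  then obtain c where "P k * (V * P x * U) = sc c 1" using irreducible by blast
  then have "P k * (P k * (V * P x * U)) = P k * sc c 1" by simp
  then have "U * (V * P x * U) * V = sc c (U * P k * V)" by simp
  then have x_k: "P x = sc c (U * P k * V)" by (simp add: mult.assoc)
  have "(U * P k * V) * (U * P k * V) = 1" by (simp add: mult.assoc)
  then have "P x * P x = sc (c * c) 1" by (simp add: x_k)
  then have "sc (c * c) 1 = sc 1 1" by simp
  then have "c * c = 1" by (rule sc_one_inj)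
  then have "sc c (P x) = U * P k * V" by (simp add: x_k)
  moreover have "c = sgn_bit 0 \<or> c = sgn_bit 1"
    using \<open>c * c = 1\<close> by (simp add: square_eq_1_iff)
  ultimately show ?thesis by metis
qed

text \<open>\<open>M\<close> collects the labels of the operators \<open>V * P x * U\<close> with
  \<open>x\<close> in \<open>L\<close>. Conjugation preserves products and commutation, so
  \<open>M\<close> is again an isotropic subspace of order 8, hence Lagrangian because 8 squared is
  64.\<close>

theorem exists_lagrangian_pair:
  "\<exists>L M. closed L \<and> perp L = L \<and> closed M \<and> perp M = M \<and>
    (\<forall>k\<in>M. \<exists>x\<in>L. \<exists>e. U * P k * V = sc (sgn_bit e) (P x)) \<and>
    (\<forall>x\<in>L. \<exists>k\<in>M. \<exists>e. U * P k * V = sc (sgn_bit e) (P x))"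
proof -
  obtain L where L: "L \<subseteq> F" "closed L" "\<And>x y. x \<in> L \<Longrightarrow> y \<in> L \<Longrightarrow> om x y = 0" "card L = 8"
    using exists_fixed_lagrangian by blast
  obtain kap where kap: "\<And>x. x \<in> L \<Longrightarrow> \<exists>e. U * P (kap x) * V = sc (sgn_bit e) (P x)"
    using conj_P_fixed_is_pauli L(1) by (metis subsetD)
  let ?M = "kap ` L"
  have C_kap: "\<exists>e. C (kap x) = sc (sgn_bit e) (P x)" if "x \<in> L" for x
    using kap[OF that] by (simp add: C_def)
  have "inj_on kap L"
  proof (rule inj_onI)
    fix x y assume xy: "x \<in> L" "y \<in> L" "kap x = kap y"
    obtain e f where "C (kap x) = sc (sgn_bit e) (P x)" "C (kap y) = sc (sgn_bit f) (P y)"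
      using C_kap xy by blast
    then have "sc (sgn_bit e) (P x) = sc (sgn_bit f) (P y)" using xy(3) by simp
    then have "P x = sc (sgn_bit f / sgn_bit e) (P y)" by (rule sc_cancel) simp
    then show "x = y" by (rule P_eq_sc_P)
  qed
  then have card: "card ?M = 8" using L(4) by (simp add: card_image)
  have iso: "om (kap x) (kap y) = 0" if xy: "x \<in> L" "y \<in> L" for x y
  proof -
    obtain e f where ef: "C (kap x) = sc (sgn_bit e) (P x)" "C (kap y) = sc (sgn_bit f) (P y)"
      using C_kap xy by blast
    have "C (kap x) * C (kap y) = sc (sgn_bit (om (kap x) (kap y))) (C (kap y) * C (kap x))"
      by (simp add: C_mult ph_commute[of "kap x"] add.commute)
    moreover have "C (kap x) * C (kap y) = C (kap y) * C (kap x)"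
      using L(3)[OF xy] by (simp add: ef P_commute[of x y] mult.commute)
    ultimately have "sc (sgn_bit (om (kap x) (kap y))) (C (kap y) * C (kap x)) = sc (sgn_bit 0) (C (kap y) * C (kap x))"
      by simp
    then have "sgn_bit (om (kap x) (kap y)) = (sgn_bit 0 :: complex)"
      by (rule sc_invertible_inj[where B = "C (kap x) * C (kap y)"]) (simp add: mult.assoc)
    then show ?thesis by (simp only: sgn_bit_inj)
  qed
  have add: "kap x + kap y = kap (x + y)" if xy: "x \<in> L" "y \<in> L" for x y
  proof -
    obtain e f where ef: "C (kap x) = sc (sgn_bit e) (P x)" "C (kap y) = sc (sgn_bit f) (P y)"
      using C_kap xy by blast
    obtain g where g: "C (kap (x + y)) = sc (sgn_bit g) (P (x + y))"
      using C_kap closed_add[OF L(2) xy] by blast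
    have "sc (ph (kap x) (kap y)) (C (kap x + kap y)) = C (kap x) * C (kap y)"
      by (simp add: C_mult)
    also have "\<dots> = sc (sgn_bit e * sgn_bit f * ph x y * sgn_bit g) (C (kap (x + y)))"
      by (simp add: ef g P_mult ac_simps)
    finally have "C (kap x + kap y) =
        sc (sgn_bit e * sgn_bit f * ph x y * sgn_bit g / ph (kap x) (kap y)) (C (kap (x + y)))"
      by (rule sc_cancel) simp
    then have "V * C (kap x + kap y) * U =
        sc (sgn_bit e * sgn_bit f * ph x y * sgn_bit g / ph (kap x) (kap y)) (V * C (kap (x + y)) * U)"
      by simp
    then have "P (kap x + kap y) =
        sc (sgn_bit e * sgn_bit f * ph x y * sgn_bit g / ph (kap x) (kap y)) (P (kap (x + y)))"
      by (simp add: C_def mult.assoc)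
    then show ?thesis by (rule P_eq_sc_P)
  qed
  have closed: "closed ?M"
  proof (rule closedI)
    have "kap 0 + kap 0 = kap (0 + 0)" using L(2) by (intro add) (simp_all add: closed_0)
    then have "kap 0 = 0" by simp
    then show "0 \<in> ?M" using L(2) closed_0 by (metis imageI)
    show "k + m \<in> ?M" if "k \<in> ?M" "m \<in> ?M" for k m
      using that add L(2) closed_add by auto
  qed
  have "perp ?M = ?M"
    using closed by (rule perp_eq_self) (use iso in \<open>auto simp: card card_UNIV\<close>)
  moreover have "perp L = L"
    using L(2,3) by (rule perp_eq_self) (simp_all add: L(4) card_UNIV)
  ultimately show ?thesis
    using L(2) closed kap by (intro exI[of _ L] exI[of _ ?M]) (fast intro: imageI)
qed

end

section \<open>The three-qubit Pauli group\<close>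

lemma kronecker_carrier:
  assumes "A \<in> carrier_mat m m" "B \<in> carrier_mat n n"
  shows "kronecker A B \<in> carrier_mat (m * n) (m * n)"
  using assms by (simp add: kronecker_def)

lemma index_kronecker:
  assumes "A \<in> carrier_mat m m" "B \<in> carrier_mat n n" "i < m * n" "j < m * n"
  shows "kronecker A B $$ (i, j) = A $$ (i div n, j div n) * B $$ (i mod n, j mod n)"
  using assms by (simp add: kronecker_def)

lemma sum_div_mod:
  fixes f :: "nat \<Rightarrow> nat \<Rightarrow> 'a::comm_monoid_add"
  shows "(\<Sum>k<m * n. f (k div n) (k mod n)) = (\<Sum>i<m. \<Sum>j<n. f i j)"
proof (cases "n = 0")
  case False
  have lt: "i * n + j < m * n" if "i < m" "j < n" for i j
  proof -
    have "i * n + j < Suc i * n" using that by simp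
    also have "\<dots> \<le> m * n" using that by (intro mult_le_mono1) simp
    finally show ?thesis .
  qed
  have "(\<Sum>i<m. \<Sum>j<n. f i j) = (\<Sum>(i, j)\<in>{..<m} \<times> {..<n}. f i j)"
    by (rule sum.cartesian_product)
  also have "\<dots> = (\<Sum>k<m * n. f (k div n) (k mod n))"
    by (rule sum.reindex_bij_witness[of _ "\<lambda>k. (k div n, k mod n)" "\<lambda>(i, j). i * n + j"])
      (use False lt in \<open>auto simp: less_mult_imp_div_less\<close>)
  finally show ?thesis ..
qed simp

text \<open>A summation index below \<open>m * n\<close> is a quotient and a remainder by
  \<open>n\<close>, and the resulting double sum factors. This is the mixed-product rule.\<close>

lemma kronecker_mult:
  assumes A: "A \<in> carrier_mat m m" "A' \<in> carrier_mat m m"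
    and B: "B \<in> carrier_mat n n" "B' \<in> carrier_mat n n"
  shows "kronecker A B * kronecker A' B' = kronecker (A * A') (B * B')"
proof (rule eq_matI)
  note K = kronecker_carrier[OF A(1) B(1)] kronecker_carrier[OF A(2) B(2)]
    and AA = mult_carrier_mat[OF A] and BB = mult_carrier_mat[OF B]
  note KK = kronecker_carrier[OF AA BB]
  fix i j assume "i < dim_row (kronecker (A * A') (B * B'))" "j < dim_col (kronecker (A * A') (B * B'))"
  then have i: "i < m * n" and j: "j < m * n" using KK by auto
  then have "n > 0" by (cases n) auto
  have im: "i div n < m" "i mod n < n" "j div n < m" "j mod n < n"
    using i j \<open>n > 0\<close> by (auto simp: less_mult_imp_div_less)
  have "(kronecker A B * kronecker A' B') $$ (i, j) =
      (\<Sum>k<m * n. kronecker A B $$ (i, k) * kronecker A' B' $$ (k, j))"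
    using K i j by (simp add: scalar_prod_def atLeast0LessThan)
  also have "\<dots> = (\<Sum>k<m * n. (\<lambda>p q. (A $$ (i div n, p) * A' $$ (p, j div n)) *
      (B $$ (i mod n, q) * B' $$ (q, j mod n))) (k div n) (k mod n))"
    by (rule sum.cong) (simp_all add: index_kronecker[OF A(1) B(1)] index_kronecker[OF A(2) B(2)] i j)
  also have "\<dots> = (\<Sum>p<m. \<Sum>q<n. (A $$ (i div n, p) * A' $$ (p, j div n)) *
      (B $$ (i mod n, q) * B' $$ (q, j mod n)))"
    by (rule sum_div_mod)
  also have "\<dots> = (\<Sum>p<m. A $$ (i div n, p) * A' $$ (p, j div n)) *
      (\<Sum>q<n. B $$ (i mod n, q) * B' $$ (q, j mod n))"
    by (simp only: sum_product)
  also have "\<dots> = (A * A') $$ (i div n, j div n) * (B * B') $$ (i mod n, j mod n)"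
    using A B im by (simp add: scalar_prod_def atLeast0LessThan)
  also have "\<dots> = kronecker (A * A') (B * B') $$ (i, j)"
    by (rule index_kronecker[OF AA BB i j, symmetric])
  finally show "(kronecker A B * kronecker A' B') $$ (i, j) = kronecker (A * A') (B * B') $$ (i, j)" .
qed (use assms in \<open>auto simp: kronecker_def\<close>)

lemma kronecker_smult: "kronecker (a \<cdot>\<^sub>m A) (b \<cdot>\<^sub>m B) = (a * b) \<cdot>\<^sub>m kronecker A B"
proof (rule eq_matI)
  fix i j
  assume "i < dim_row ((a * b) \<cdot>\<^sub>m kronecker A B)" "j < dim_col ((a * b) \<cdot>\<^sub>m kronecker A B)"
  then have "i < dim_row A * dim_row B" "j < dim_col A * dim_col B" by (simp_all add: kronecker_def)
  moreover from this have "dim_row B > 0" "dim_col B > 0" by (auto intro!: Nat.gr0I)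
  ultimately show "kronecker (a \<cdot>\<^sub>m A) (b \<cdot>\<^sub>m B) $$ (i, j) = ((a * b) \<cdot>\<^sub>m kronecker A B) $$ (i, j)"
    by (simp add: kronecker_def less_mult_imp_div_less)
qed (simp_all add: kronecker_def)

lemma kronecker_one_right: "A \<in> carrier_mat m m \<Longrightarrow> kronecker A (1\<^sub>m 1) = A"
  by (rule eq_matI) (auto simp: kronecker_def)

lemma kronecker_one_one: "kronecker (1\<^sub>m m) (1\<^sub>m n) = 1\<^sub>m (m * n)"
proof (rule eq_matI)
  fix i j assume "i < dim_row (1\<^sub>m (m * n))" "j < dim_col (1\<^sub>m (m * n))"
  then have ij: "i < m * n" "j < m * n" by simp_all
  then have "n > 0" by (cases n) auto
  moreover have "i = j \<longleftrightarrow> i div n = j div n \<and> i mod n = j mod n"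
    by (metis div_mult_mod_eq)
  ultimately show "kronecker (1\<^sub>m m) (1\<^sub>m n) $$ (i, j) = 1\<^sub>m (m * n) $$ (i, j)"
    using ij by (auto simp: kronecker_def less_mult_imp_div_less)
qed (simp_all add: kronecker_def)

section \<open>Single-qubit Paulis, their phases and signs\<close>

text \<open>The label $(a, b)$ stands for $X^a Z^b$ up to phase.\<close>

definition pauli1 :: "bit \<times> bit \<Rightarrow> complex mat" where
  "pauli1 p = (case p of (a, b) \<Rightarrow>
    if a = 0 then (if b = 0 then pauli_I else pauli_Z) else (if b = 0 then pauli_X else pauli_Y))"

text \<open>The multiplication table of the Pauli matrices: the listed pairs are
  \<open>X Y = i Z\<close>, \<open>Y Z = i X\<close> and \<open>Z X = i Y\<close>.\<close>

definition phase1 :: "bit \<times> bit \<Rightarrow> bit \<times> bit \<Rightarrow> complex" where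
  "phase1 p q = (if p = 0 \<or> q = 0 \<or> p = q then 1
    else if (p, q) \<in> {((1, 0), (1, 1)), ((1, 1), (0, 1)), ((0, 1), (1, 0))} then \<i> else - \<i>)"

definition om1 :: "bit \<times> bit \<Rightarrow> bit \<times> bit \<Rightarrow> bit" where
  "om1 p q = fst p * snd q + snd p * fst q"

lemma pauli1_carrier: "pauli1 p \<in> carrier_mat 2 2"
  by (auto simp: pauli1_def pauli_I_def pauli_X_def pauli_Y_def pauli_Z_def mat_of_rows_list_def split: prod.split)

lemma pauli1_0: "pauli1 0 = 1\<^sub>m 2"
  by (rule eq_matI) (auto simp: pauli1_def zero_prod_def pauli_I_def mat_of_rows_list_def less_2_cases_iff)

lemma all_bit_pair_iff: "(\<forall>p :: bit \<times> bit. Q p) \<longleftrightarrow> Q (0, 0) \<and> Q (0, 1) \<and> Q (1, 0) \<and> Q (1, 1)"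
  by (metis bit_not_zero_iff surj_pair)

lemma pauli1_mult: "pauli1 p * pauli1 q = phase1 p q \<cdot>\<^sub>m pauli1 (p + q)"
proof -
  have "\<forall>p q. pauli1 p * pauli1 q = phase1 p q \<cdot>\<^sub>m pauli1 (p + q)"
    unfolding all_bit_pair_iff
    by (intro conjI; rule eq_matI)
      (auto simp: pauli1_def phase1_def pauli_I_def pauli_X_def pauli_Y_def pauli_Z_def zero_prod_def
        mat_of_rows_list_def scalar_prod_def less_Suc_eq numeral_2_eq_2)
  then show ?thesis by blast
qed

lemma phase1_commute: "phase1 p q = sgn_bit (om1 p q) * phase1 q p"
proof -
  have "\<forall>p q. phase1 p q = sgn_bit (om1 p q) * phase1 q p"
    unfolding all_bit_pair_iff by (simp add: phase1_def om1_def zero_prod_def)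
  then show ?thesis by blast
qed

definition phases :: "complex set" where "phases = {1, - 1, \<i>, - \<i>}"

lemma phases_mult: "a \<in> phases \<Longrightarrow> b \<in> phases \<Longrightarrow> a * b \<in> phases"
  by (auto simp: phases_def)

lemma phases_inverse: "a \<in> phases \<Longrightarrow> inverse a \<in> phases"
  by (auto simp: phases_def)

lemma phases_nonzero: "a \<in> phases \<Longrightarrow> a \<noteq> 0"
  by (auto simp: phases_def)

lemma phase1_in_phases: "phase1 p q \<in> phases"
  by (simp add: phase1_def phases_def)

section \<open>Labels of three-qubit Paulis as a symplectic space of order 64\<close>

type_synonym label = "(bit \<times> bit) \<times> (bit \<times> bit) \<times> (bit \<times> bit)"

definition pauli :: "label \<Rightarrow> complex mat" where
  "pauli x = (case x of (p, q, r) \<Rightarrow> kronecker (pauli1 p) (kronecker (pauli1 q) (pauli1 r)))"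

definition phase :: "label \<Rightarrow> label \<Rightarrow> complex" where
  "phase x y = (case (x, y) of ((p, q, r), (p', q', r')) \<Rightarrow> phase1 p p' * (phase1 q q' * phase1 r r'))"

definition om :: "label \<Rightarrow> label \<Rightarrow> bit" where
  "om x y = (case (x, y) of ((p, q, r), (p', q', r')) \<Rightarrow> om1 p p' + (om1 q q' + om1 r r'))"

lemma pauli_carrier [simp]: "pauli x \<in> carrier_mat 8 8"
  using kronecker_carrier[OF pauli1_carrier kronecker_carrier[OF pauli1_carrier pauli1_carrier]]
  by (simp add: pauli_def split: prod.split)

lemma pauli_mult: "pauli x * pauli y = phase x y \<cdot>\<^sub>m pauli (x + y)"
  by (simp add: pauli_def phase_def kronecker_mult[OF pauli1_carrier pauli1_carrier
        kronecker_carrier[OF pauli1_carrier pauli1_carrier] kronecker_carrier[OF pauli1_carrier pauli1_carrier]]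
      kronecker_mult[OF pauli1_carrier pauli1_carrier pauli1_carrier pauli1_carrier]
      pauli1_mult kronecker_smult split: prod.split)

lemma pauli_0: "pauli 0 = 1\<^sub>m 8"
  by (simp add: pauli_def zero_prod_def[where ?'b = "(bit \<times> bit) \<times> (bit \<times> bit)"]
      zero_prod_def[where ?'b = "bit \<times> bit"] pauli1_0 kronecker_one_one)

lemma phase_in_phases: "phase x y \<in> phases"
  by (simp add: phase_def phase1_in_phases phases_mult split: prod.split)

lemma phase_commute: "phase x y = sgn_bit (om x y) * phase y x"
proof -
  obtain p q r p' q' r' where xy: "x = (p, q, r)" "y = (p', q', r')"
    by (metis prod.exhaust)
  show ?thesis
    unfolding xy phase_def om_def prod.case sgn_bit_add
    by (simp only: phase1_commute[of p p'] phase1_commute[of q q'] phase1_commute[of r r'] ac_simps)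
qed

lemma om1_self: "om1 p p = 0"
  by (simp only: om1_def mult.commute[of "snd p"] bit_add_self)

lemma om1_add: "om1 (p + q) r = om1 p r + om1 q r" "om1 p (q + r) = om1 p q + om1 p r"
  by (simp_all only: om1_def fst_add snd_add distrib_left distrib_right ac_simps)

lemma om_add: "om (x + y) z = om x z + om y z" "om x (y + z) = om x y + om x z"
proof -
  obtain p q r p' q' r' p'' q'' r'' where "x = (p, q, r)" "y = (p', q', r')" "z = (p'', q'', r'')"
    by (metis prod.exhaust)
  then show "om (x + y) z = om x z + om y z" "om x (y + z) = om x y + om x z"
    by (simp_all only: om_def prod.case add_Pair om1_add ac_simps)
qed

lemma card_UNIV_prod:
  "card (UNIV :: ('a \<times> 'b) set) = card (UNIV :: 'a set) * card (UNIV :: 'b set)"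
  unfolding UNIV_Times_UNIV[symmetric] by (rule card_cartesian_product)

lemma card_label: "card (UNIV :: label set) = 64"
proof -
  have "x \<in> {0, 1}" for x :: bit by (cases x) simp_all
  then have "UNIV = {0, 1 :: bit}" by blast
  then have "card (UNIV :: bit set) = card {0, 1 :: bit}" by (rule arg_cong)
  also have "\<dots> = 2" by simp
  finally show ?thesis by (simp add: card_UNIV_prod)
qed

interpretation symplectic om
proof
  fix x y z :: label
  show "x + x = 0" by (cases x) (simp add: zero_prod_def prod_eq_iff)
  show "om (x + y) z = om x z + om y z" "om x (y + z) = om x y + om x z"
    by (fact om_add)+
  show "om x x = 0" by (cases x) (simp add: om_def om1_self)
  show "finite (UNIV :: label set)" by (rule card_ge_0_finite) (simp add: card_label)
next
  fix x :: label
  assume "\<And>y. om x y = 0"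
  \<comment> \<open>Pairing with the six basis vectors reads off the six coordinates of
    \<open>x\<close>.\<close>
  from this[of "((1, 0), 0, 0)"] this[of "((0, 1), 0, 0)"] this[of "(0, (1, 0), 0)"]
    this[of "(0, (0, 1), 0)"] this[of "(0, 0, (1, 0))"] this[of "(0, 0, (0, 1))"]
  show "x = 0" by (cases x) (auto simp: om_def om1_def zero_prod_def)
qed

section \<open>Irreducibility of the three-qubit Paulis\<close>

lemma index_pauli:
  assumes "i < 8" "j < 8"
  shows "pauli (p, q, r) $$ (i, j) = pauli1 p $$ (i div 4, j div 4) *
    (pauli1 q $$ (i mod 4 div 2, j mod 4 div 2) * pauli1 r $$ (i mod 4 mod 2, j mod 4 mod 2))"
proof -
  have carrier: "kronecker (pauli1 q) (pauli1 r) \<in> carrier_mat 4 4"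
    using kronecker_carrier[OF pauli1_carrier pauli1_carrier, of q r] by simp
  have ij: "i < 2 * 4" "j < 2 * 4" using assms by simp_all
  have mod: "i mod 4 < 2 * 2" "j mod 4 < 2 * 2" by simp_all
  show ?thesis
    unfolding pauli_def prod.case index_kronecker[OF pauli1_carrier carrier ij]
      index_kronecker[OF pauli1_carrier pauli1_carrier mod] ..
qed

text \<open>Tensor products of \<open>I\<close> and \<open>Z\<close> are diagonal, and
  \<open>Z\<close> on one qubit reads one binary digit of the index. Distinct indices differ in some
  digit.\<close>

lemma exists_diagonal_pauli:
  assumes "i < 8" "j < 8" "i \<noteq> j"
  shows "\<exists>x. diagonal_mat (pauli x) \<and> pauli x $$ (i, i) \<noteq> pauli x $$ (j, j)"
proof -
  define x where "x b1 b2 b3 = (((0, b1), (0, b2), (0, b3)) :: label)" for b1 b2 b3 :: bit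
  have Z: "pauli1 (0, c) $$ (a, b) = (if a = b then if a = 0 then 1 else sgn_bit c else 0)"
    if "a < 2" "b < 2" for a b c
    using that by (cases c) (auto simp: pauli1_def pauli_I_def pauli_Z_def mat_of_rows_list_def less_Suc_eq numeral_2_eq_2)
  have bounds: "a div 4 < 2" "a mod 4 div 2 < 2" "a mod 4 mod 2 < 2" if "a < 8" for a :: nat
    using that by auto
  have split: "a = b"
    if "a div 4 = b div 4" "a mod 4 div 2 = b mod 4 div 2" "a mod 4 mod 2 = b mod 4 mod 2" for a b :: nat
    using that by (metis div_mult_mod_eq)
  have index_x: "pauli (x b1 b2 b3) $$ (a, b) =
      (if a div 4 = b div 4 then if a div 4 = 0 then 1 else sgn_bit b1 else 0) *
      ((if a mod 4 div 2 = b mod 4 div 2 then if a mod 4 div 2 = 0 then 1 else sgn_bit b2 else 0) *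
       (if a mod 4 mod 2 = b mod 4 mod 2 then if a mod 4 mod 2 = 0 then 1 else sgn_bit b3 else 0))"
    if "a < 8" "b < 8" for a b b1 b2 b3
    unfolding x_def index_pauli[OF that]
    by (simp only: Z[OF bounds(1)[OF that(1)] bounds(1)[OF that(2)]]
        Z[OF bounds(2)[OF that(1)] bounds(2)[OF that(2)]] Z[OF bounds(3)[OF that(1)] bounds(3)[OF that(2)]])
  have diag: "diagonal_mat (pauli (x b1 b2 b3))" for b1 b2 b3
    unfolding diagonal_mat_def carrier_matD[OF pauli_carrier]
  proof (intro allI impI)
    fix a b :: nat assume ab: "a < 8" "b < 8" "a \<noteq> b"
    then consider "a div 4 \<noteq> b div 4" | "a mod 4 div 2 \<noteq> b mod 4 div 2" | "a mod 4 mod 2 \<noteq> b mod 4 mod 2"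
      using split by blast
    then show "pauli (x b1 b2 b3) $$ (a, b) = 0"
      unfolding index_x[OF ab(1,2)] by cases (simp_all only: if_False mult_zero_left mult_zero_right)
  qed
  have diag_x: "pauli (x b1 b2 b3) $$ (a, a) = (if a div 4 = 0 then 1 else sgn_bit b1) *
      ((if a mod 4 div 2 = 0 then 1 else sgn_bit b2) * (if a mod 4 mod 2 = 0 then 1 else sgn_bit b3))"
    if "a < 8" for a b1 b2 b3
    unfolding index_x[OF that that] by (simp only: if_True refl)
  have ne: "(if Q then 1 else sgn_bit 1) \<noteq> (if R then 1 else sgn_bit 1 :: complex)" if "Q \<noteq> R" for Q R
    using that by auto
  note one = sgn_bit_0 if_cancel mult_1_left mult_1_right
  have lt2: "a = b" if "(a = 0) = (b = 0)" "a < 2" "b < 2" for a b :: nat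
    using that by auto
  have "i = j" if "(i div 4 = 0) = (j div 4 = 0)" "(i mod 4 div 2 = 0) = (j mod 4 div 2 = 0)"
    "(i mod 4 mod 2 = 0) = (j mod 4 mod 2 = 0)"
    by (rule split[OF lt2[OF that(1) bounds(1) bounds(1)] lt2[OF that(2) bounds(2) bounds(2)]
          lt2[OF that(3) bounds(3) bounds(3)]]) (simp_all add: assms)
  then consider "(i div 4 = 0) \<noteq> (j div 4 = 0)" | "(i mod 4 div 2 = 0) \<noteq> (j mod 4 div 2 = 0)"
    | "(i mod 4 mod 2 = 0) \<noteq> (j mod 4 mod 2 = 0)"
    using assms(3) by argo
  then show ?thesis
  proof cases
    case 1
    then have "pauli (x 1 0 0) $$ (i, i) \<noteq> pauli (x 1 0 0) $$ (j, j)"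
      unfolding diag_x[OF assms(1)] diag_x[OF assms(2)] one by (rule ne)
    then show ?thesis using diag by blast
  next
    case 2
    then have "pauli (x 0 1 0) $$ (i, i) \<noteq> pauli (x 0 1 0) $$ (j, j)"
      unfolding diag_x[OF assms(1)] diag_x[OF assms(2)] one by (rule ne)
    then show ?thesis using diag by blast
  next
    case 3
    then have "pauli (x 0 0 1) $$ (i, i) \<noteq> pauli (x 0 0 1) $$ (j, j)"
      unfolding diag_x[OF assms(1)] diag_x[OF assms(2)] one by (rule ne)
    then show ?thesis using diag by blast
  qed
qed

text \<open>A tensor product of \<open>I\<close> and \<open>X\<close> flips any chosen binary digits
  of the index 0.\<close>

lemma exists_pauli_0_nonzero:
  assumes "j < 8"
  shows "\<exists>x. pauli x $$ (0, j) \<noteq> 0"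
proof -
  have "\<exists>p. pauli1 p $$ (0, b) \<noteq> 0" if "b < 2" for b
  proof -
    have "pauli1 0 $$ (0, 0) \<noteq> 0" "pauli1 (1, 0) $$ (0, 1) \<noteq> 0"
      by (simp add: pauli1_0, simp add: pauli1_def pauli_X_def mat_of_rows_list_def)
    moreover have "b = 0 \<or> b = 1" using that by auto
    ultimately show ?thesis by blast
  qed
  moreover have "j div 4 < 2" "j mod 4 div 2 < 2" "j mod 4 mod 2 < 2" using assms by auto
  ultimately obtain p q r where
    "pauli1 p $$ (0, j div 4) \<noteq> 0" "pauli1 q $$ (0, j mod 4 div 2) \<noteq> 0" "pauli1 r $$ (0, j mod 4 mod 2) \<noteq> 0"
    by meson
  then have "pauli (p, q, r) $$ (0, j) \<noteq> 0" using assms by (simp add: index_pauli)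
  then show ?thesis ..
qed

text \<open>Comparing entries with a diagonal Pauli that separates \<open>i\<close> and
  \<open>j\<close> kills the off-diagonal entry; comparing with a Pauli nonzero at
  \<open>(0, j)\<close> then equates the diagonal entries.\<close>

lemma pauli_irreducible:
  assumes A: "A \<in> carrier_mat 8 8" and comm: "\<And>x. A * pauli x = pauli x * A"
  shows "\<exists>c. A = c \<cdot>\<^sub>m 1\<^sub>m 8"
proof -
  have entry: "(\<Sum>k<8. A $$ (i, k) * pauli x $$ (k, j)) = (\<Sum>k<8. pauli x $$ (i, k) * A $$ (k, j))"
    if "i < 8" "j < 8" for i j x
  proof -
    have "(A * pauli x) $$ (i, j) = (pauli x * A) $$ (i, j)" by (simp only: comm)
    then show ?thesis
      using that A carrier_matD[OF pauli_carrier[of x]] by (simp add: scalar_prod_def atLeast0LessThan)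
  qed
  have diag: "A $$ (i, j) = 0" if ij: "i < 8" "j < 8" "i \<noteq> j" for i j
  proof -
    obtain x where x: "diagonal_mat (pauli x)" "pauli x $$ (i, i) \<noteq> pauli x $$ (j, j)"
      using exists_diagonal_pauli[OF ij] by blast
    have off: "pauli x $$ (k, l) = 0" if "k < 8" "l < 8" "k \<noteq> l" for k l
      using x(1) that carrier_matD[OF pauli_carrier[of x]] by (simp add: diagonal_mat_def)
    have "(\<Sum>k<8. A $$ (i, k) * pauli x $$ (k, j)) = A $$ (i, j) * pauli x $$ (j, j)"
      using ij off by (subst sum.remove[of _ j]) auto
    moreover have "(\<Sum>k<8. pauli x $$ (i, k) * A $$ (k, j)) = pauli x $$ (i, i) * A $$ (i, j)"
      using ij off by (subst sum.remove[of _ i]) auto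
    ultimately have "A $$ (i, j) * pauli x $$ (j, j) = pauli x $$ (i, i) * A $$ (i, j)"
      using entry[OF ij(1,2), of x] by metis
    then show ?thesis using x(2) x(2)[symmetric] by (auto simp: mult.commute)
  qed
  have const: "A $$ (j, j) = A $$ (0, 0)" if j: "j < 8" for j
  proof -
    obtain x where x: "pauli x $$ (0, j) \<noteq> 0" using exists_pauli_0_nonzero[OF j] by blast
    have "(\<Sum>k<8. A $$ (0, k) * pauli x $$ (k, j)) = A $$ (0, 0) * pauli x $$ (0, j)"
      using j diag by (subst sum.remove[of _ 0]) auto
    moreover have "(\<Sum>k<8. pauli x $$ (0, k) * A $$ (k, j)) = pauli x $$ (0, j) * A $$ (j, j)"
      using j diag by (subst sum.remove[of _ j]) auto
    ultimately have "A $$ (0, 0) * pauli x $$ (0, j) = pauli x $$ (0, j) * A $$ (j, j)"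
      using entry[of 0 j x, OF _ j] by (metis zero_less_numeral)
    then show ?thesis using x by (simp add: mult.commute[of "A $$ (0, 0)"])
  qed
  have "A = A $$ (0, 0) \<cdot>\<^sub>m 1\<^sub>m 8"
  proof (rule eq_matI)
    fix i j assume "i < dim_row (A $$ (0, 0) \<cdot>\<^sub>m 1\<^sub>m 8)" "j < dim_col (A $$ (0, 0) \<cdot>\<^sub>m 1\<^sub>m 8)"
    then have ij: "i < 8" "j < 8" by simp_all
    show "A $$ (i, j) = (A $$ (0, 0) \<cdot>\<^sub>m 1\<^sub>m 8) $$ (i, j)"
      by (cases "i = j") (simp_all add: ij diag, simp only: const[OF ij(2)])
  qed (use A in simp_all)
  then show ?thesis ..
qed

section \<open>The 8 by 8 matrices as a monoid with scalars\<close>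

typedef op3 = "carrier_mat 8 8 :: complex mat set"
  by (rule exI[of _ "1\<^sub>m 8"]) simp

setup_lifting type_definition_op3

text \<open>\<open>pauli_representation\<close> asks for a type of class \<open>monoid_mult\<close>;
  on the type cut out by the carrier condition the matrix laws hold unconditionally.\<close>

instantiation op3 :: monoid_mult
begin

lift_definition one_op3 :: op3 is "1\<^sub>m 8" by simp

lift_definition times_op3 :: "op3 \<Rightarrow> op3 \<Rightarrow> op3" is "(*)" by simp

instance
  by standard (transfer; simp)+

end

lift_definition scale :: "complex \<Rightarrow> op3 \<Rightarrow> op3" is "\<lambda>c A. c \<cdot>\<^sub>m A" by simp

lift_definition pauli_op :: "label \<Rightarrow> op3" is pauli by simp

lemma smult_smult_mat: "a \<cdot>\<^sub>m (b \<cdot>\<^sub>m A) = (a * b) \<cdot>\<^sub>m (A :: complex mat)"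
  by (rule eq_matI) simp_all

lemma one_smult_mat: "1 \<cdot>\<^sub>m A = (A :: complex mat)"
  by (rule eq_matI) simp_all

lemma phase_self: "phase x x = 1"
  by (simp add: phase_def phase1_def split: prod.split)

lemma pauli_square: "pauli x * pauli x = 1\<^sub>m 8"
  by (simp add: pauli_mult phase_self pauli_0 one_smult_mat)

interpretation paulis: pauli_representation om scale pauli_op phase
proof
  fix a b A B x y
  show "scale a A * B = scale a (A * B)"
    by transfer (rule mult_smult_assoc_mat)
  show "A * scale a B = scale a (A * B)"
    by transfer (rule mult_smult_distrib)
  show "scale a (scale b A) = scale (a * b) A"
    by transfer (rule smult_smult_mat)
  show "scale 1 A = A"
    by transfer (rule one_smult_mat)
  show "a = b" if "scale a 1 = scale b 1"
    using that
  proof transfer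
    fix a b :: complex
    assume "a \<cdot>\<^sub>m 1\<^sub>m 8 = b \<cdot>\<^sub>m 1\<^sub>m 8"
    then have "(a \<cdot>\<^sub>m 1\<^sub>m 8) $$ (0, 0) = (b \<cdot>\<^sub>m 1\<^sub>m 8) $$ (0, 0)" by (rule arg_cong)
    then show "a = b" by simp
  qed
  show "pauli_op x * pauli_op y = scale (phase x y) (pauli_op (x + y))"
    by transfer (rule pauli_mult)
  show "phase x y \<noteq> 0" by (rule phases_nonzero[OF phase_in_phases])
  show "phase x y = sgn_bit (om x y) * phase y x" by (rule phase_commute)
  show "pauli_op 0 = 1" by transfer (rule pauli_0)
  show "pauli_op x * pauli_op x = 1" by transfer (rule pauli_square)
  show "\<exists>c. A = scale c 1" if "\<And>x. A * pauli_op x = pauli_op x * A"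
    using that by transfer (rule pauli_irreducible)
qed

text \<open>The full preimage of \<open>L\<close> under the map from the Pauli group to labels. It
  contains all four phases of each Pauli, as a maximal abelian subgroup must.\<close>

definition pauli_span :: "label set \<Rightarrow> complex mat set" where
  "pauli_span L = {c \<cdot>\<^sub>m pauli x | c x. c \<in> phases \<and> x \<in> L}"

lemma pauli_spanI: "c \<in> phases \<Longrightarrow> x \<in> L \<Longrightarrow> c \<cdot>\<^sub>m pauli x \<in> pauli_span L"
  unfolding pauli_span_def by blast

lemma pauli_spanE:
  assumes "A \<in> pauli_span L"
  obtains c x where "A = c \<cdot>\<^sub>m pauli x" "c \<in> phases" "x \<in> L"
  using assms unfolding pauli_span_def by blast

lemma pauli_in_pauli_span: "x \<in> L \<Longrightarrow> pauli x \<in> pauli_span L"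
  using pauli_spanI[of 1 x L] by (simp add: one_smult_mat phases_def)

lemma range_pauli1: "range pauli1 = {pauli_I, pauli_X, pauli_Y, pauli_Z}"
proof -
  have "UNIV = {(0, 0), (1, 0), (1, 1), (0, 1 :: bit) :: bit \<times> bit}"
    using all_bit_pair_iff[of "\<lambda>p. p \<in> {(0, 0), (1, 0), (1, 1), (0, 1)}"] by auto
  then have "range pauli1 = pauli1 ` {(0, 0), (1, 0), (1, 1), (0, 1)}" by simp
  then show ?thesis by (simp add: pauli1_def)
qed

lemma pauli_ops_3: "pauli_ops 3 = pauli_span UNIV"
proof -
  have tensor: "tensor_list [pauli1 p, pauli1 q, pauli1 r] = pauli (p, q, r)" for p q r
    by (simp add: tensor_list_def pauli_def kronecker_one_right[OF pauli1_carrier] del: One_nat_def)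
  have "{tensor_list xs | xs. length xs = 3 \<and> set xs \<subseteq> range pauli1} = range pauli"
  proof (intro equalityI subsetI)
    fix A assume "A \<in> {tensor_list xs | xs. length xs = 3 \<and> set xs \<subseteq> range pauli1}"
    then obtain xs where "A = tensor_list xs" "length xs = 3" "set xs \<subseteq> range pauli1" by blast
    then obtain p q r where "A = tensor_list [pauli1 p, pauli1 q, pauli1 r]"
      by (auto simp: numeral_3_eq_3 length_Suc_conv)
    then show "A \<in> range pauli" by (simp add: tensor)
  next
    fix A assume "A \<in> range pauli"
    then obtain p q r where "A = pauli (p, q, r)" by (metis imageE prod_cases3)
    then have "A = tensor_list [pauli1 p, pauli1 q, pauli1 r]" by (simp add: tensor)
    moreover have "length [pauli1 p, pauli1 q, pauli1 r] = 3" "set [pauli1 p, pauli1 q, pauli1 r] \<subseteq> range pauli1"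
      by simp_all
    ultimately show "A \<in> {tensor_list xs | xs. length xs = 3 \<and> set xs \<subseteq> range pauli1}" by blast
  qed
  moreover have "pauli_ops 3 = {c \<cdot>\<^sub>m A | c A. c \<in> phases \<and>
      A \<in> {tensor_list xs | xs. length xs = 3 \<and> set xs \<subseteq> range pauli1}}"
    unfolding pauli_ops_def phases_def range_pauli1 by blast
  ultimately have "pauli_ops 3 = {c \<cdot>\<^sub>m A | c A. c \<in> phases \<and> A \<in> range pauli}"
    by simp
  then show ?thesis unfolding pauli_span_def by blast
qed

lemma smult_pauli_mult:
  "(c \<cdot>\<^sub>m pauli x) * (d \<cdot>\<^sub>m pauli y) = (c * d * phase x y) \<cdot>\<^sub>m pauli (x + y)"
proof -
  have "(c \<cdot>\<^sub>m pauli x) * (d \<cdot>\<^sub>m pauli y) = c \<cdot>\<^sub>m (pauli x * (d \<cdot>\<^sub>m pauli y))"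
    by (rule mult_smult_assoc_mat[of _ 8 8 _ 8]) simp_all
  also have "pauli x * (d \<cdot>\<^sub>m pauli y) = d \<cdot>\<^sub>m (pauli x * pauli y)"
    by (rule mult_smult_distrib[of _ 8 8 _ 8]) simp_all
  finally show ?thesis by (simp add: pauli_mult smult_smult_mat ac_simps)
qed

lemma pauli_span_mult:
  assumes "closed L" "A \<in> pauli_span L" "B \<in> pauli_span L"
  shows "A * B \<in> pauli_span L"
proof -
  obtain c x where A: "A = c \<cdot>\<^sub>m pauli x" "c \<in> phases" "x \<in> L"
    using assms(2) by (rule pauli_spanE)
  obtain d y where B: "B = d \<cdot>\<^sub>m pauli y" "d \<in> phases" "y \<in> L"
    using assms(3) by (rule pauli_spanE)
  show ?thesis
    using assms(1) A B by (simp add: smult_pauli_mult pauli_spanI phases_mult phase_in_phases closed_add)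
qed

lemma one_in_pauli_span: "closed L \<Longrightarrow> 1\<^sub>m 8 \<in> pauli_span L"
  using pauli_in_pauli_span[of 0 L] by (simp add: pauli_0 closed_0)

lemma pauli_span_inverse:
  assumes "A \<in> pauli_span L"
  shows "\<exists>B\<in>pauli_span L. B * A = 1\<^sub>m 8"
proof -
  obtain c x where A: "A = c \<cdot>\<^sub>m pauli x" "c \<in> phases" "x \<in> L"
    using assms by (rule pauli_spanE)
  have "(inverse c \<cdot>\<^sub>m pauli x) * A = 1\<^sub>m 8"
    using phases_nonzero[OF A(2)]
    by (simp add: A(1) smult_pauli_mult phase_self pauli_0 one_smult_mat)
  then show ?thesis using A phases_inverse pauli_spanI by blast
qed

lemma pauli_span_carrier: "A \<in> pauli_span L \<Longrightarrow> A \<in> carrier_mat 8 8"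
  by (erule pauli_spanE) simp

section \<open>Lagrangian subspaces and maximal abelian subgroups\<close>

lemma pauli_group_3: "pauli_group 3 = \<lparr>carrier = pauli_span UNIV, monoid.mult = (*), one = 1\<^sub>m 8\<rparr>"
  by (simp add: pauli_group_def pauli_ops_3)

lemma closed_UNIV: "closed UNIV"
  by (simp add: closed_def)

lemma group_pauli_group: "group (pauli_group 3)"
  unfolding pauli_group_3
proof (rule groupI; simp only: monoid.simps partial_object.simps)
  fix A B C assume "A \<in> pauli_span UNIV" "B \<in> pauli_span UNIV" "C \<in> pauli_span UNIV"
  then show "A * B * C = A * (B * C)" 
    by (intro assoc_mult_mat[of _ 8 8 _ 8 _ 8]) (rule pauli_span_carrier; assumption)+
next
  fix A assume "A \<in> pauli_span UNIV"
  then show "1\<^sub>m 8 * A = A" by (intro left_mult_one_mat[of _ 8 8]) (rule pauli_span_carrier)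
qed (auto intro: pauli_span_mult closed_UNIV one_in_pauli_span pauli_span_inverse)

lemma pauli_commute_imp_om_0:
  assumes "pauli x * pauli y = pauli y * pauli x"
  shows "om x y = 0"
proof -
  have "pauli_op x * pauli_op y = pauli_op y * pauli_op x"
    using assms by transfer
  then have "scale (sgn_bit (om x y)) (pauli_op y * pauli_op x) = scale (sgn_bit 0) (pauli_op y * pauli_op x)"
    by (simp flip: paulis.P_commute)
  then have "sgn_bit (om x y) = (sgn_bit 0 :: complex)"
    by (rule paulis.sc_invertible_inj[where B = "pauli_op x * pauli_op y"]) (simp add: mult.assoc)
  then show ?thesis by (simp only: sgn_bit_inj)
qed

text \<open>Isotropy of \<open>L\<close> makes the span commutative. An abelian subgroup above it
  has only elements commuting with every \<open>pauli x\<close> for \<open>x\<close> in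
  \<open>L\<close>; their labels lie in \<open>perp L\<close>, that is in \<open>L\<close>.\<close>

lemma maximal_abelian_pauli_span:
  assumes L: "closed L" and perp: "perp L = L"
  shows "maximal_abelian_subgroup (pauli_span L) (pauli_group 3)"
proof -
  interpret G: group "pauli_group 3" by (rule group_pauli_group)
  have G_simps: "carrier (pauli_group 3) = pauli_span UNIV" "x \<otimes>\<^bsub>pauli_group 3\<^esub> y = x * y"
    "\<one>\<^bsub>pauli_group 3\<^esub> = 1\<^sub>m 8" for x y
    by (simp_all add: pauli_group_3)
  have sub: "pauli_span L \<subseteq> pauli_span UNIV" unfolding pauli_span_def by blast
  have subgroup: "subgroup (pauli_span L) (pauli_group 3)"
  proof (rule G.subgroupI)
    show "pauli_span L \<subseteq> carrier (pauli_group 3)" using sub by (simp add: G_simps)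
    show "pauli_span L \<noteq> {}" using one_in_pauli_span[OF L] by blast
    show "inv\<^bsub>pauli_group 3\<^esub> A \<in> pauli_span L" if A: "A \<in> pauli_span L" for A
    proof -
      obtain B where B: "B \<in> pauli_span L" "B * A = 1\<^sub>m 8" using pauli_span_inverse[OF A] by blast
      then have "inv\<^bsub>pauli_group 3\<^esub> A = B"
        using A sub by (intro G.inv_equality) (auto simp: G_simps)
      then show ?thesis using B by simp
    qed
    show "A \<otimes>\<^bsub>pauli_group 3\<^esub> B \<in> pauli_span L" if "A \<in> pauli_span L" "B \<in> pauli_span L" for A B
      using pauli_span_mult[OF L that] by (simp add: G_simps)
  qed
  have commute: "A * B = B * A" if AB: "A \<in> pauli_span L" "B \<in> pauli_span L" for A B
  proof -
    obtain c x where x: "A = c \<cdot>\<^sub>m pauli x" "x \<in> L" using AB(1) by (rule pauli_spanE)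
    obtain d y where y: "B = d \<cdot>\<^sub>m pauli y" "y \<in> L" using AB(2) by (rule pauli_spanE)
    have "y \<in> perp L" using y(2) perp by simp
    then have "om x y = 0" using x(2) by (simp add: perp_def)
    then have "phase x y = phase y x" using phase_commute[of x y] by simp
    then show ?thesis by (simp add: x(1) y(1) smult_pauli_mult ac_simps)
  qed
  have "comm_group ((pauli_group 3)\<lparr>carrier := pauli_span L\<rparr>)"
    using G.subgroup_imp_group[OF subgroup]
    by (rule group.group_comm_groupI) (simp add: G_simps commute)
  moreover have "K = pauli_span L"
    if K: "abelian_subgroup K (pauli_group 3)" "pauli_span L \<subseteq> K" for K
  proof (intro equalityI subsetI)
    fix A assume A: "A \<in> K"
    have "K \<subseteq> pauli_span UNIV"
      using K(1) subgroup.subset[of K "pauli_group 3"] by (simp add: abelian_subgroup_def G_simps)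
    then have "A \<in> pauli_span UNIV" using A by (rule subsetD)
    then obtain c y where y: "A = c \<cdot>\<^sub>m pauli y" "c \<in> phases" by (rule pauli_spanE)
    interpret K: comm_group "(pauli_group 3)\<lparr>carrier := K\<rparr>"
      using K(1) by (simp add: abelian_subgroup_def)
    have "om x y = 0" if x: "x \<in> L" for x
    proof (rule pauli_commute_imp_om_0)
      have "pauli x \<in> K" using x K(2) pauli_in_pauli_span by blast
      then have "pauli x * A = A * pauli x" using A K.m_comm[of "pauli x" A] by (simp add: G_simps)
      moreover have "pauli x * A = c \<cdot>\<^sub>m (pauli x * pauli y)"
        unfolding y by (rule mult_smult_distrib[of _ 8 8 _ 8]) simp_all
      moreover have "A * pauli x = c \<cdot>\<^sub>m (pauli y * pauli x)"
        unfolding y by (rule mult_smult_assoc_mat[of _ 8 8 _ 8]) simp_all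
      ultimately have "inverse c \<cdot>\<^sub>m (c \<cdot>\<^sub>m (pauli x * pauli y)) = inverse c \<cdot>\<^sub>m (c \<cdot>\<^sub>m (pauli y * pauli x))"
        by simp
      then show "pauli x * pauli y = pauli y * pauli x"
        using phases_nonzero[OF y(2)] by (simp add: smult_smult_mat one_smult_mat)
    qed
    then have "y \<in> perp L" by (simp add: perp_def)
    then show "A \<in> pauli_span L" using perp y by (simp add: pauli_spanI)
  qed (use K(2) in blast)
  ultimately show ?thesis
    using subgroup by (simp add: maximal_abelian_subgroup_def abelian_subgroup_def)
qed

section \<open>Transfer to three-qubit gates of the third level\<close>

lemma mat_adjoint_carrier:
  assumes "A \<in> carrier_mat n m"
  shows "mat_adjoint A \<in> carrier_mat m n"
proof -
  have "mat_adjoint A \<in> carrier_mat (length (map conjugate (cols A))) (dim_row A)"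
    unfolding mat_adjoint_def by (rule mat_of_rows_carrier(1))
  with assms show ?thesis by (simp only: length_map cols_length carrier_matD)
qed

lemma clifford_level_SucD:
  assumes "U \<in> clifford_level n (Suc (Suc k))" "A \<in> pauli_ops n"
  shows "conj_by U A \<in> clifford_level n (Suc k)"
proof -
  have "conj_by U ` clifford_level n (Suc 0) \<subseteq> clifford_level n (Suc k)"
    using assms(1) by (simp only: clifford_level.simps(3) mem_Collect_eq)
  then show ?thesis using assms(2) by (simp only: clifford_level.simps(2) image_subset_iff)
qed

theorem theorem2:
  fixes U :: "complex mat"
  assumes "U \<in> qubit_gates 3"
    and "U \<in> clifford_level 3 3"
  shows "semi_clifford 3 U"
proof -
  define V where "V = mat_adjoint U"
  have U: "U \<in> carrier_mat 8 8" and UV: "U * V = 1\<^sub>m 8" "V * U = 1\<^sub>m 8"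
    using assms(1) by (simp_all add: qubit_gates_def V_def)
  have V: "V \<in> carrier_mat 8 8"
    unfolding V_def using U by (rule mat_adjoint_carrier)
  define U' V' where "U' = Abs_op3 U" and "V' = Abs_op3 V"
  have Rep: "Rep_op3 U' = U" "Rep_op3 V' = V"
    unfolding U'_def V'_def by (rule Abs_op3_inverse[OF U], rule Abs_op3_inverse[OF V])
  note rep_eqs = Rep times_op3.rep_eq scale.rep_eq pauli_op.rep_eq one_op3.rep_eq
  interpret third_level om scale pauli_op phase U' V'
  proof
    show "U' * V' = 1" "V' * U' = 1"
      by (simp_all add: Rep_op3_inject[symmetric] rep_eqs UV)
    show "card (UNIV :: label set) = 64" by (rule card_label)
    fix v x
    let ?C = "U * pauli v * V"
    have C: "?C \<in> carrier_mat 8 8" by (rule mult_carrier_mat[OF mult_carrier_mat[OF U pauli_carrier] V])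
    have P: "pauli z \<in> pauli_ops 3" for z
      unfolding pauli_ops_3 by (rule pauli_in_pauli_span) simp
    have "clifford_level 3 3 = clifford_level 3 (Suc (Suc (Suc 0)))"
      by (rule arg_cong) (rule numeral_3_eq_3)
    then have "U \<in> clifford_level 3 (Suc (Suc (Suc 0)))" using assms(2) by simp
    then have "conj_by U (pauli v) \<in> clifford_level 3 (Suc (Suc 0))"
      using P by (rule clifford_level_SucD)
    moreover have "conj_by U (pauli v) = ?C" by (simp only: conj_by_def V_def)
    ultimately have C_2: "?C \<in> clifford_level 3 (Suc (Suc 0))" by (simp only:)
    have level: "?C \<in> qubit_gates 3" "conj_by ?C (pauli x) \<in> pauli_ops 3"
      using clifford_level_SucD[OF C_2 P] C_2 by simp_all
    have CC: "?C * ?C = 1\<^sub>m 8"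
    proof -
      have "(U' * pauli_op v * V') * (U' * pauli_op v * V') = U' * pauli_op v * (V' * U') * pauli_op v * V'"
        by (simp only: mult.assoc)
      also have "\<dots> = U' * (pauli_op v * pauli_op v) * V'"
        using \<open>V' * U' = 1\<close> by (simp add: mult.assoc)
      also have "\<dots> = 1" using \<open>U' * V' = 1\<close> by simp
      finally show ?thesis by (simp add: Rep_op3_inject[symmetric] rep_eqs)
    qed
    have adj: "mat_adjoint ?C \<in> carrier_mat 8 8" using C by (rule mat_adjoint_carrier)
    \<comment> \<open>A unitary involution is its own adjoint, which turns \<open>conj_by ?C\<close>
      into the form that \<open>third_level\<close> expects.\<close>
    have "mat_adjoint ?C = (?C * ?C) * mat_adjoint ?C" using adj by (simp add: CC)
    also have "\<dots> = ?C * (?C * mat_adjoint ?C)" using C adj by (intro assoc_mult_mat)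
    also have "?C * mat_adjoint ?C = 1\<^sub>m 8" using level(1) by (simp add: qubit_gates_def)
    also have "?C * 1\<^sub>m 8 = ?C" using C by (rule right_mult_one_mat)
    finally have "conj_by ?C (pauli x) = ?C * pauli x * ?C" by (simp add: conj_by_def)
    then have "?C * pauli x * ?C \<in> pauli_span UNIV"
      using level(2) by (simp only: pauli_ops_3)
    then obtain c y where "?C * pauli x * ?C = c \<cdot>\<^sub>m pauli y" by (rule pauli_spanE)
    then have "(U' * pauli_op v * V') * pauli_op x * (U' * pauli_op v * V') = scale c (pauli_op y)"
      by (simp add: Rep_op3_inject[symmetric] rep_eqs)
    then show "\<exists>c y. U' * pauli_op v * V' * pauli_op x * (U' * pauli_op v * V') = scale c (pauli_op y)"
      by blast
  qed
  obtain L M where L: "closed L" "perp L = L" and M: "closed M" "perp M = M"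
    and M_L: "\<And>k. k \<in> M \<Longrightarrow> \<exists>x\<in>L. \<exists>e. U' * pauli_op k * V' = scale (sgn_bit e) (pauli_op x)"
    and L_M: "\<And>x. x \<in> L \<Longrightarrow> \<exists>k\<in>M. \<exists>e. U' * pauli_op k * V' = scale (sgn_bit e) (pauli_op x)"
    using exists_lagrangian_pair by blast
  have conj: "conj_by U (c \<cdot>\<^sub>m pauli k) = (c * sgn_bit e) \<cdot>\<^sub>m pauli x"
    if "U' * pauli_op k * V' = scale (sgn_bit e) (pauli_op x)" for c k e x
  proof -
    have "U' * scale c (pauli_op k) * V' = scale (c * sgn_bit e) (pauli_op x)"
      using that by simp
    then have "Rep_op3 (U' * scale c (pauli_op k) * V') = Rep_op3 (scale (c * sgn_bit e) (pauli_op x))"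
      by (rule arg_cong)
    then show ?thesis by (simp only: rep_eqs conj_by_def V_def)
  qed
  have sgn_phase: "sgn_bit e \<in> phases" for e
    by (cases e) (simp_all add: phases_def)
  \<comment> \<open>The signs in the correspondence between \<open>M\<close> and \<open>L\<close>
    are absorbed because each span contains all phases.\<close>
  have "conj_by U ` pauli_span M = pauli_span L"
  proof (intro equalityI subsetI)
    fix A assume "A \<in> conj_by U ` pauli_span M"
    then obtain B where B: "A = conj_by U B" "B \<in> pauli_span M" by (rule imageE)
    from B(2) obtain c k where A: "B = c \<cdot>\<^sub>m pauli k" "c \<in> phases" "k \<in> M"
      by (rule pauli_spanE)
    obtain x e where x: "x \<in> L" "U' * pauli_op k * V' = scale (sgn_bit e) (pauli_op x)"
      using M_L[OF A(3)] by blast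
    show "A \<in> pauli_span L"
      unfolding B(1) A(1) conj[OF x(2)] using A(2) x(1) by (intro pauli_spanI phases_mult sgn_phase)
  next
    fix A assume "A \<in> pauli_span L"
    then obtain c x where A: "A = c \<cdot>\<^sub>m pauli x" "c \<in> phases" "x \<in> L"
      by (rule pauli_spanE)
    obtain k e where k: "k \<in> M" "U' * pauli_op k * V' = scale (sgn_bit e) (pauli_op x)"
      using L_M[OF A(3)] by blast
    have "A = conj_by U ((c * sgn_bit e) \<cdot>\<^sub>m pauli k)"
      by (simp add: conj[OF k(2)] A(1) mult.assoc)
    moreover have "(c * sgn_bit e) \<cdot>\<^sub>m pauli k \<in> pauli_span M"
      using k(1) A(2) by (intro pauli_spanI phases_mult sgn_phase)
    ultimately show "A \<in> conj_by U ` pauli_span M" by (rule image_eqI)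
  qed
  then have "maximal_abelian_subgroup (conj_by U ` pauli_span M) (pauli_group 3)"
    using maximal_abelian_pauli_span[OF L] by (simp only:)
  with maximal_abelian_pauli_span[OF M] show ?thesis
    unfolding semi_clifford_def using assms(1) by blast
qed

end
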